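(* Let $f:\mathbb{R}^{n+m}\to\mathbb{R}$ be a $C^2$ function such that $\nabla f$ is globally Lipschitz with constant $L>0$ and $\nabla^2 f(z^\ast)$ is invertible at every saddle point $z^\ast$ of $f$. Let $\tau>0$ and, for a saddle point $z^\ast$ of $f$, define $$M=M(z^\ast)=\begin{cases}\dfrac{\big|\max_{\lambda\in\sigma(\Lambda_\tau H(z^\ast))}\Re(\lambda)\big|}{\max\{L^2,L^2/\tau^2\}}&\text{if }\max_{\lambda\in\sigma(\Lambda_\tau H(z^\ast))}\Re(\lambda)<0,\\[2mm]\infty&\text{if }\max_{\lambda\in\sigma(\Lambda_\tau H(z^\ast))}\Re(\lambda)=0.\end{cases}$$ (i) Let $\gamma>0$ and consider the ODE $\dot z=-\gamma\Lambda_\tau F(z)$. The set of saddle points of $f$ is a subset of the set of exponentially stable equilibria of this ODE if, for every saddle point $z^\ast$, $\Re(\lambda)\ne0$ for all $\lambda\in\sigma(\Lambda_\tau H(z^\ast))$. (ii) Consider the ODE $\dot z=\big(-I+(1-\tfrac{\gamma}{2})s\Lambda_\tau\nabla F(z)\big)\gamma\Lambda_\tau F(z)$. The set of saddle points of $f$ is a subset of the set of exponentially stable equilibria of this ODE if $0<\gamma<2$ and, for every saddle point $z^\ast$, $0<s<\min\{M(z^\ast),\min\{L^{-1},\tfrac{\tau}{L}\}\}$.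
   Context: Write $z=(x,y)\in\mathbb{R}^n\times\mathbb{R}^m$. A (local) saddle point of $f$ is a point $(x^\ast,y^\ast)$ having a neighbourhood $U$ such that $f(x^\ast,y)\le f(x^\ast,y^\ast)\le f(x,y^\ast)$ for all $(x,y)\in U$. Notation: $F(z)=\begin{bmatrix}\nabla_x f(z)\\-\nabla_y f(z)\end{bmatrix}$, $\nabla F$ is the Jacobian matrix of $F$, $H(z)=-\nabla F(z)=\begin{bmatrix}-\nabla^2_{xx}f(z)&-\nabla^2_{xy}f(z)\\ \nabla^2_{yx}f(z)&\nabla^2_{yy}f(z)\end{bmatrix}$, $\Lambda_\tau=\begin{bmatrix}\frac1\tau I&0\\0&I\end{bmatrix}$ (blocks of sizes $n$ and $m$); $\sigma(\cdot)$ is the spectrum. (It is known that all eigenvalues of $\Lambda_\tau H(z^\ast)$ at a saddle point $z^\ast$ have nonpositive real part, so $M$ is well defined.) An equilibrium $Z^e$ of an ODE is exponentially stable (meant locally) if it is stable (for every $\varepsilon>0$ there is $\delta>0$ such that $|Z(0)-Z^e|<\delta$ implies $|Z(t)-Z^e|<\varepsilon$ for all $t\ge0$) and there exist $\delta,M',\lambda>0$ such that $|Z(0)-Z^e|<\delta$ implies $|Z(t)-Z^e|\le M'e^{-\lambda t}|Z(0)-Z^e|$ for all $t\ge0$. (The ODEs in (i) and (ii) are the $O(1)$- and $O(s)$-resolution ODEs of the Generalised Extragradient iteration $z_{k+1}=z_k-\gamma s\Lambda_\tau F(z_k-s\Lambda_\tau F(z_k))$.) *)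

theory Defs
  imports "HOL-Analysis.Analysis"
begin

text \<open>
  The space of all \<open>z = (x, y)\<close> with \<open>x\<close> in n-space and \<open>y\<close> in m-space is \<open>real ^ ('n + 'm)\<close>:
  the indices \<open>Inl i\<close> are those of \<open>x\<close>, the indices \<open>Inr j\<close> those of \<open>y\<close>. Its norm is the
  Euclidean one, and block matrices are matrices indexed by \<open>'n + 'm\<close>.
\<close>

definition join :: "real ^ 'n \<Rightarrow> real ^ 'm \<Rightarrow> real ^ ('n::finite + 'm::finite)" where
  "join x y = (\<chi> k. case k of Inl i \<Rightarrow> x $ i | Inr j \<Rightarrow> y $ j)"

definition grad :: "(real ^ 'k \<Rightarrow> real) \<Rightarrow> real ^ 'k \<Rightarrow> real ^ 'k::finite" where
  "grad f z = (\<chi> k. frechet_derivative f (at z) (axis k 1))"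

definition hessian :: "(real ^ 'k \<Rightarrow> real) \<Rightarrow> real ^ 'k \<Rightarrow> real ^ 'k ^ 'k::finite" where
  "hessian f z = jacobian (grad f) (at z)"

definition C2_fun :: "(real ^ 'k::finite \<Rightarrow> real) \<Rightarrow> bool" where
  "C2_fun f \<longleftrightarrow> (\<forall>z. f differentiable (at z)) \<and> (\<forall>z. grad f differentiable (at z)) \<and>
     continuous_on UNIV (hessian f)"

definition saddle_point :: "(real ^ ('n::finite + 'm::finite) \<Rightarrow> real) \<Rightarrow> real ^ ('n + 'm) \<Rightarrow> bool" where
  "saddle_point f z \<longleftrightarrow> (\<exists>xs ys U. z = join xs ys \<and> open U \<and> z \<in> U \<and>
     (\<forall>x y. join x y \<in> U \<longrightarrow>
        f (join xs y) \<le> f (join xs ys) \<and> f (join xs ys) \<le> f (join x ys)))"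

definition saddle_field ::
    "(real ^ ('n::finite + 'm::finite) \<Rightarrow> real) \<Rightarrow> real ^ ('n + 'm) \<Rightarrow> real ^ ('n + 'm)" where
  "saddle_field f z =
     (\<chi> k. case k of Inl i \<Rightarrow> grad f z $ Inl i | Inr j \<Rightarrow> - (grad f z $ Inr j))"

definition H_mat ::
    "(real ^ ('n::finite + 'm::finite) \<Rightarrow> real) \<Rightarrow> real ^ ('n + 'm) \<Rightarrow> real ^ ('n + 'm) ^ ('n + 'm)" where
  "H_mat f z = - jacobian (saddle_field f) (at z)"

lemma H_mat_blocks:
  assumes "grad f differentiable (at z)"
  shows "H_mat f z $ Inl i $ l = - (hessian f z $ Inl i $ l)"
    and "H_mat f z $ Inr j $ l = hessian f z $ Inr j $ l"
proof -
  define S :: "real ^ ('a + 'b) \<Rightarrow> real ^ ('a + 'b)" where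
    "S v = (\<chi> k. case k of Inl i \<Rightarrow> v $ Inl i | Inr j \<Rightarrow> - (v $ Inr j))" for v
  have "linear S"
    by (rule linearI) (auto simp: S_def vec_eq_iff split: sum.split)
  then have S: "bounded_linear S"
    by (simp add: linear_conv_bounded_linear)
  have "(grad f has_derivative (\<lambda>h. hessian f z *v h)) (at z)"
    using assms unfolding hessian_def by (simp add: jacobian_works)
  from bounded_linear.has_derivative[OF S this]
  have "(saddle_field f has_derivative (\<lambda>h. S (hessian f z *v h))) (at z)"
    by (simp add: S_def saddle_field_def[abs_def])
  then have "frechet_derivative (saddle_field f) (at z) = (\<lambda>h. S (hessian f z *v h))"
    by (rule frechet_derivative_at[symmetric])
  then have *: "H_mat f z $ k $ l = - (S (hessian f z *v axis l 1) $ k)" for k l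
    by (simp add: H_mat_def jacobian_def matrix_def)
  show "H_mat f z $ Inl i $ l = - (hessian f z $ Inl i $ l)"
    and "H_mat f z $ Inr j $ l = hessian f z $ Inr j $ l"
    unfolding * by (simp_all add: S_def matrix_vector_mult_basis column_def)
qed

definition Lambda_mat :: "real \<Rightarrow> real ^ ('n::finite + 'm::finite) ^ ('n + 'm)" where
  "Lambda_mat \<tau> =
     (\<chi> k l. if k = l then (case k of Inl i \<Rightarrow> 1 / \<tau> | Inr j \<Rightarrow> 1) else 0)"

text \<open>The spectrum of a real matrix is its set of complex eigenvalues.\<close>

definition cspectrum :: "real ^ 'k ^ 'k::finite \<Rightarrow> complex set" where
  "cspectrum A = {\<mu>. \<exists>v. v \<noteq> 0 \<and> map_matrix complex_of_real A *v v = \<mu> *s v}"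

definition spectral_abscissa :: "real ^ 'k ^ 'k::finite \<Rightarrow> real" where
  "spectral_abscissa A = Max (Re ` cspectrum A)"

text \<open>
  At a saddle point \<open>z\<close> the spectral abscissa of \<open>Lambda_mat \<tau> ** H_mat f z\<close> is never positive,
  so the second branch below is the case of spectral abscissa 0.
\<close>

definition M_bound ::
    "(real ^ ('n::finite + 'm::finite) \<Rightarrow> real) \<Rightarrow> real \<Rightarrow> real \<Rightarrow> real ^ ('n + 'm) \<Rightarrow> ereal" where
  "M_bound f L \<tau> z =
     (let a = spectral_abscissa (Lambda_mat \<tau> ** H_mat f z)
      in if a < 0 then ereal (\<bar>a\<bar> / max (L\<^sup>2) (L\<^sup>2 / \<tau>\<^sup>2)) else \<infinity>)"

text \<open>
  Solutions of the autonomous ODE \<open>Z' = V(Z)\<close> are taken on all compact intervals \<open>[0, T]\<close>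
  (one-sided derivatives at the end points) instead of only on \<open>[0, \<infinity>)\<close>. So the estimates in the
  stability notions hold along every solution for as long as it exists. In particular they exclude
  finite-time blow-up, and they do not hold vacuously for lack of global solutions. No uniqueness
  of solutions is assumed.
\<close>

definition solves_ode_upto ::
    "(real \<Rightarrow> 'a::real_normed_vector) \<Rightarrow> ('a \<Rightarrow> 'a) \<Rightarrow> real \<Rightarrow> bool" where
  "solves_ode_upto Z V T \<longleftrightarrow>
     (\<forall>t\<in>{0..T}. (Z has_vector_derivative V (Z t)) (at t within {0..T}))"

definition stable_at :: "('a::real_normed_vector \<Rightarrow> 'a) \<Rightarrow> 'a \<Rightarrow> bool" where
  "stable_at V Ze \<longleftrightarrow>
     (\<forall>\<epsilon>>0. \<exists>\<delta>>0. \<forall>Z T. T > 0 \<and> solves_ode_upto Z V T \<and> norm (Z 0 - Ze) < \<delta> \<longrightarrow>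
        (\<forall>t\<in>{0..T}. norm (Z t - Ze) < \<epsilon>))"

definition exp_attracting_at :: "('a::real_normed_vector \<Rightarrow> 'a) \<Rightarrow> 'a \<Rightarrow> bool" where
  "exp_attracting_at V Ze \<longleftrightarrow>
     (\<exists>\<delta>>0. \<exists>C>0. \<exists>\<kappa>>0. \<forall>Z T. T > 0 \<and> solves_ode_upto Z V T \<and> norm (Z 0 - Ze) < \<delta> \<longrightarrow>
        (\<forall>t\<in>{0..T}. norm (Z t - Ze) \<le> C * exp (- \<kappa> * t) * norm (Z 0 - Ze)))"

definition exp_stable_equilibrium :: "('a::real_normed_vector \<Rightarrow> 'a) \<Rightarrow> 'a \<Rightarrow> bool" where
  "exp_stable_equilibrium V Ze \<longleftrightarrow> V Ze = 0 \<and> stable_at V Ze \<and> exp_attracting_at V Ze"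

end

theory Submission
  imports Defs "HOL-Computational_Algebra.Fundamental_Theorem_Algebra"
begin

text \<open>
  Write \<open>A = \<Lambda> H(z)\<close> at a saddle point \<open>z\<close>. The linearisations of the two ODEs at \<open>z\<close> are
  \<open>\<gamma> A\<close> and \<open>\<gamma> (A + c A\<^sup>2)\<close> with \<open>c = (1 - \<gamma>/2) s\<close>. The second order conditions at a saddle point
  and the symmetry of the Hessian give \<open>u \<bullet> H u \<le> 0\<close>, so that \<open>Re \<mu> \<le> 0\<close> for every eigenvalue \<open>\<mu>\<close>
  of \<open>A\<close>. In the first case \<open>Re \<mu> < 0\<close> follows from the hypothesis. In the second case the eigenvalues
  are \<open>\<gamma> (\<mu> + c \<mu>\<^sup>2)\<close>, with real part \<open>\<gamma> (Re \<mu> (1 + c Re \<mu>) - c (Im \<mu>)\<^sup>2)\<close>; this is negative because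
  \<open>\<mu> \<noteq> 0\<close> and \<open>c \<bar>\<mu>\<bar> < 1\<close>.

  A Hurwitz matrix \<open>B\<close> has a quadratic Lyapunov function: if the product of \<open>B - r\<^sub>1, \<dots>, B - r\<^sub>N\<close>
  vanishes for eigenvalues \<open>r\<^sub>i\<close> and \<open>u\<^sub>k = (B - r\<^sub>k) \<dots> (B - r\<^sub>1) u\<close>, then \<open>u\<^sub>k' = r\<^sub>k\<^sub>+\<^sub>1 u\<^sub>k + u\<^sub>k\<^sub>+\<^sub>1\<close> along
  \<open>u' = B u\<close>, and the sum of the \<open>w\<^sub>k \<bar>u\<^sub>k\<bar>\<^sup>2\<close> decays when the weights \<open>w\<^sub>k\<close> grow fast enough. The same
  function controls every nonlinear field with derivative \<open>B\<close> at the equilibrium, which need not be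
  differentiable elsewhere.
\<close>

section \<open>Quadratic Lyapunov functions\<close>

text \<open>The factor \<open>exp (- \<kappa> * t)\<close> is at most 1, so the distance never
  exceeds \<open>C\<close> times the initial one and a start within \<open>\<epsilon> / C\<close>
  suffices.\<close>

lemma exp_attracting_imp_stable:
  assumes "exp_attracting_at V z"
  shows "stable_at V z"
  unfolding stable_at_def
proof (intro allI impI)
  fix \<epsilon> :: real
  assume "\<epsilon> > 0"
  from assms obtain \<delta> C \<kappa> where "\<delta> > 0" "C > 0" "\<kappa> > 0"
    and est: "\<And>Z T t. T > 0 \<Longrightarrow> solves_ode_upto Z V T \<Longrightarrow> norm (Z 0 - z) < \<delta> \<Longrightarrow>
      t \<in> {0..T} \<Longrightarrow> norm (Z t - z) \<le> C * exp (- \<kappa> * t) * norm (Z 0 - z)"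
    unfolding exp_attracting_at_def by metis
  show "\<exists>\<delta>>0. \<forall>Z T. T > 0 \<and> solves_ode_upto Z V T \<and> norm (Z 0 - z) < \<delta> \<longrightarrow>
        (\<forall>t\<in>{0..T}. norm (Z t - z) < \<epsilon>)"
  proof (intro exI[of _ "min \<delta> (\<epsilon> / C)"] conjI allI impI ballI)
    show "min \<delta> (\<epsilon> / C) > 0"
      using \<open>\<delta> > 0\<close> \<open>\<epsilon> > 0\<close> \<open>C > 0\<close> by simp
    fix Z T t
    assume *: "0 < T \<and> solves_ode_upto Z V T \<and> norm (Z 0 - z) < min \<delta> (\<epsilon> / C)" and t: "t \<in> {0..T}"
    have "norm (Z t - z) \<le> C * exp (- \<kappa> * t) * norm (Z 0 - z)"
      using * t by (intro est) auto
    also have "\<dots> \<le> C * 1 * norm (Z 0 - z)"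
      using \<open>C > 0\<close> \<open>\<kappa> > 0\<close> t by (intro mult_right_mono mult_left_mono) auto
    also have "\<dots> < \<epsilon>"
      using * \<open>C > 0\<close> by (simp add: field_simps)
    finally show "norm (Z t - z) < \<epsilon>" .
  qed
qed

lemma solves_ode_upto_continuous_on:
  "solves_ode_upto Z V T \<Longrightarrow> continuous_on {0..T} Z"
  unfolding solves_ode_upto_def continuous_on_eq_continuous_within
  by (blast intro: has_vector_derivative_continuous)

text \<open>The product \<open>exp (a * x) * q x\<close> has nonpositive derivative.
  Differentiability is asked for at interior points only, because solutions have one-sided
  derivatives at the end points.\<close>

lemma gronwall_decay:
  fixes q :: "real \<Rightarrow> real"
  assumes cont: "continuous_on {0..t} q" and "0 \<le> t"
    and der: "\<And>x. 0 < x \<Longrightarrow> x < t \<Longrightarrow> \<exists>d. (q has_real_derivative d) (at x) \<and> d \<le> - a * q x"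
  shows "q t \<le> exp (- a * t) * q 0"
proof -
  have "exp (a * t) * q t \<le> exp (a * 0) * q 0"
  proof (rule DERIV_nonpos_imp_decreasing_open[OF \<open>0 \<le> t\<close>, where f = "\<lambda>x. exp (a * x) * q x"])
    show "continuous_on {0..t} (\<lambda>x. exp (a * x) * q x)"
      by (intro continuous_intros cont)
    fix x assume "0 < x" "x < t"
    then obtain d where d: "(q has_real_derivative d) (at x)" "d \<le> - a * q x"
      using der by blast
    have "((\<lambda>x. exp (a * x) * q x) has_real_derivative exp (a * x) * (a * q x + d)) (at x)"
      by (auto intro!: derivative_eq_intros d(1) simp: algebra_simps)
    moreover have "exp (a * x) * (a * q x + d) \<le> 0"
      using d(2) by (simp add: mult_le_0_iff)
    ultimately show "\<exists>y. ((\<lambda>x. exp (a * x) * q x) has_real_derivative y) (at x) \<and> y \<le> 0"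
      by blast
  qed
  then show ?thesis
    by (simp add: exp_minus field_simps)
qed

text \<open>By symmetry of \<open>P\<close> the derivative of \<open>P (Z x - z) (Z x - z)\<close>
  is twice the quantity bounded in \<open>near\<close>, hence the rate \<open>2 * a\<close>. The
  bound is required strictly before \<open>t\<close>, so that \<open>t\<close> may be a time at
  which the solution leaves the region where it holds.\<close>

lemma lyapunov_decay:
  fixes P :: "'a::real_normed_vector \<Rightarrow> 'a \<Rightarrow> real"
  assumes P: "bounded_bilinear P" and sym: "\<And>u v. P u v = P v u"
    and sol: "solves_ode_upto Z V T" and t: "t \<in> {0..T}"
    and near: "\<And>x. 0 < x \<Longrightarrow> x < t \<Longrightarrow> P (Z x - z) (V (Z x)) \<le> - a * P (Z x - z) (Z x - z)"
  shows "P (Z t - z) (Z t - z) \<le> exp (- (2 * a) * t) * P (Z 0 - z) (Z 0 - z)"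
proof (rule gronwall_decay[where q = "\<lambda>x. P (Z x - z) (Z x - z)"])
  interpret P: bounded_bilinear P by fact
  show "0 \<le> t" using t by simp
  have "continuous_on {0..t} Z"
    using solves_ode_upto_continuous_on[OF sol] t by (auto elim: continuous_on_subset)
  then show "continuous_on {0..t} (\<lambda>x. P (Z x - z) (Z x - z))"
    by (intro P.continuous_on continuous_intros)
  fix x assume x: "0 < x" "x < t"
  with t have "x \<in> {0<..<T}" by auto
  with sol have "(Z has_vector_derivative V (Z x)) (at x)"
    unfolding solves_ode_upto_def by (metis at_within_Icc_at atLeastAtMost_iff greaterThanLessThan_iff less_imp_le)
  then have Z': "((\<lambda>x. Z x - z) has_vector_derivative V (Z x)) (at x)"
    by (auto intro!: derivative_eq_intros)
  have "((\<lambda>x. P (Z x - z) (Z x - z)) has_real_derivative 2 * P (Z x - z) (V (Z x))) (at x)"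
    using P.has_vector_derivative[OF Z' Z'] sym[of "V (Z x)"]
    by (simp add: has_real_derivative_iff_has_vector_derivative)
  then show "\<exists>d. ((\<lambda>x. P (Z x - z) (Z x - z)) has_real_derivative d) (at x) \<and>
      d \<le> - (2 * a) * P (Z x - z) (Z x - z)"
    using near[OF x] by fastforce
qed

text \<open>Near \<open>z\<close> the nonlinear remainder costs at most half of the decay rate of
  the linear part. A first exit argument then shows that solutions starting close enough never leave
  that neighbourhood.\<close>

theorem lyapunov_exp_stable:
  fixes V :: "'a::real_normed_vector \<Rightarrow> 'a" and P :: "'a \<Rightarrow> 'a \<Rightarrow> real"
  assumes eq: "V z = 0" and der: "(V has_derivative B) (at z)"
    and P: "bounded_bilinear P" and sym: "\<And>u v. P u v = P v u"
    and pos: "\<And>v. (norm v)\<^sup>2 \<le> P v v"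
    and \<kappa>: "\<kappa> > 0" and neg: "\<And>v. P v (B v) \<le> - \<kappa> * P v v"
  shows "exp_stable_equilibrium V z"
proof -
  interpret P: bounded_bilinear P by fact
  obtain K where K: "K > 0" "\<And>u v. norm (P u v) \<le> norm u * norm v * K"
    using P.pos_bounded by blast
  \<comment> \<open>The remainder enters through \<open>P\<close> with the factor \<open>K\<close>,
    so a relative error \<open>a / K\<close> costs at most \<open>a * P\<close>. Out of
    \<open>\<kappa> = 2 * a\<close> the rate \<open>a\<close> remains.\<close>
  define a where "a = \<kappa> / 2"
  have "a > 0" using \<kappa> by (simp add: a_def)
  obtain r where r: "r > 0"
    "\<And>y. norm (y - z) < r \<Longrightarrow> norm (V y - V z - B (y - z)) \<le> a / K * norm (y - z)"
    using der \<open>a > 0\<close> \<open>K > 0\<close> unfolding has_derivative_at_alt by (metis divide_pos_pos)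
  have near: "P (y - z) (V y) \<le> - a * P (y - z) (y - z)" if "norm (y - z) < r" for y
  proof -
    have "P (y - z) (V y) = P (y - z) (B (y - z)) + P (y - z) (V y - V z - B (y - z))"
      by (simp add: P.diff_right eq)
    also have "P (y - z) (V y - V z - B (y - z)) \<le> norm (y - z) * (a / K * norm (y - z)) * K"
      using K(1) r(2)[OF that] order_trans[OF abs_ge_self K(2)[unfolded real_norm_def]]
      by (meson less_eq_real_def mult_left_mono mult_right_mono norm_ge_zero order_trans)
    also have "\<dots> = a * (norm (y - z))\<^sup>2"
      using K(1) by (simp add: power2_eq_square)
    also have "\<dots> \<le> a * P (y - z) (y - z)"
      using \<open>a > 0\<close> pos by simp
    also have "P (y - z) (B (y - z)) \<le> - \<kappa> * P (y - z) (y - z)" by (rule neg)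
    finally show ?thesis by (simp add: a_def field_simps)
  qed
  \<comment> \<open>\<open>C\<^sup>2\<close> dominates the bound \<open>K\<close> of
    \<open>P\<close>, and the summand 1 keeps \<open>C\<close> at least 1.\<close>
  define C where "C = sqrt (K + 1)"
  have C: "C \<ge> 1" using K(1) by (simp add: C_def)
  have upper: "P v v \<le> C\<^sup>2 * (norm v)\<^sup>2" for v
    using K(2)[of v v] K(1) by (simp add: C_def power2_eq_square algebra_simps add_increasing)
  have "norm (Z t - z) \<le> C * exp (- a * t) * norm (Z 0 - z)"
    if sol: "solves_ode_upto Z V T" and init: "norm (Z 0 - z) < r / C" and t: "t \<in> {0..T}" for Z T t
  proof -
    \<comment> \<open>The solution is assumed inside the ball before \<open>s\<close> only, so the
      estimate also applies at the first exit time.\<close>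
    have bound: "norm (Z s - z) \<le> C * exp (- a * s) * norm (Z 0 - z)"
      if s: "s \<in> {0..T}" and inside: "\<And>x. 0 < x \<Longrightarrow> x < s \<Longrightarrow> norm (Z x - z) < r" for s
    proof (rule power2_le_imp_le)
      have "(norm (Z s - z))\<^sup>2 \<le> P (Z s - z) (Z s - z)" by (rule pos)
      also have "\<dots> \<le> exp (- (2 * a) * s) * P (Z 0 - z) (Z 0 - z)"
        by (rule lyapunov_decay[OF P sym sol s]) (blast intro: near inside)
      also have "\<dots> \<le> exp (- (2 * a) * s) * (C\<^sup>2 * (norm (Z 0 - z))\<^sup>2)"
        by (simp add: upper)
      also have "\<dots> = (C * exp (- a * s) * norm (Z 0 - z))\<^sup>2"
        by (simp add: power_mult_distrib flip: exp_double)
      finally show "(norm (Z s - z))\<^sup>2 \<le> (C * exp (- a * s) * norm (Z 0 - z))\<^sup>2" .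
    qed (use C in auto)
    have "norm (Z s - z) < r" if "s \<in> {0..T}" for s
    proof (rule ccontr)
      assume "\<not> norm (Z s - z) < r"
      \<comment> \<open>\<open>S\<close> is the set of times outside the ball. It is closed, so its
        infimum is a first exit time, and there \<open>bound\<close> contradicts the choice of the
        initial radius \<open>r / C\<close>.\<close>
      define S where "S = {x \<in> {0..T}. r \<le> norm (Z x - z)}"
      have "closed S"
        unfolding S_def
        by (intro continuous_on_closed_Collect_le continuous_intros closed_atLeastAtMost
              solves_ode_upto_continuous_on[OF sol])
      have "s \<in> S" using that \<open>\<not> norm (Z s - z) < r\<close> by (simp add: S_def)
      have bdd: "bdd_below S" by (auto simp: S_def bdd_below_def)
      define s0 where "s0 = Inf S"
      have s0: "s0 \<in> S" unfolding s0_def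
        using \<open>s \<in> S\<close> bdd \<open>closed S\<close> by (intro closed_contains_Inf) auto
      have "norm (Z x - z) < r" if "0 < x" "x < s0" for x
        using cInf_lower[OF _ bdd, of x] that s0 by (force simp: S_def s0_def)
      then have "norm (Z s0 - z) \<le> C * exp (- a * s0) * norm (Z 0 - z)"
        using s0 by (intro bound) (auto simp: S_def)
      also have "\<dots> \<le> C * 1 * norm (Z 0 - z)"
        using C \<open>a > 0\<close> s0 by (intro mult_right_mono mult_left_mono) (auto simp: S_def)
      also have "\<dots> < r" using init C by (simp add: field_simps)
      finally show False using s0 by (simp add: S_def)
    qed
    then show ?thesis using t by (intro bound) auto
  qed
  moreover have "r / C > 0" "C > 0" using r(1) C by auto
  ultimately have "exp_attracting_at V z"
    unfolding exp_attracting_at_def using \<open>a > 0\<close> by blast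
  then show ?thesis
    by (simp add: exp_stable_equilibrium_def eq exp_attracting_imp_stable)
qed

section \<open>Lyapunov functions of Hurwitz matrices\<close>

definition char_shift :: "complex ^ 'k ^ 'k \<Rightarrow> complex \<Rightarrow> complex ^ 'k \<Rightarrow> complex ^ 'k::finite" where
  "char_shift C r u = C *v u - r *s u"

text \<open>This is the product of the factors \<open>C - r\<close> applied to \<open>u\<close>,
  with the head of the list acting last. The factors commute, so any of them can be moved to either
  end.\<close>

definition shifts :: "complex ^ 'k ^ 'k \<Rightarrow> complex list \<Rightarrow> complex ^ 'k \<Rightarrow> complex ^ 'k::finite" where
  "shifts C rs u = foldr (char_shift C) rs u"

lemma char_shift_commute: "char_shift C r (char_shift C r' u) = char_shift C r' (char_shift C r u)"
  by (simp add: char_shift_def matrix_vector_mult_diff_distrib vector_scalar_commute vec_eq_iff algebra_simps)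

lemma char_shift_scale: "char_shift C r (c *s u) = c *s char_shift C r u"
  by (simp add: char_shift_def vector_scalar_commute vector_ssub_ldistrib vector_smult_assoc mult.commute)

lemma shifts_simps [simp]:
  "shifts C [] u = u" "shifts C (r # rs) u = char_shift C r (shifts C rs u)"
  by (simp_all add: shifts_def)

lemma shifts_append: "shifts C (rs @ rs') u = shifts C rs (shifts C rs' u)"
  by (simp add: shifts_def)

lemma shifts_char_shift: "shifts C rs (char_shift C r u) = char_shift C r (shifts C rs u)"
  by (induction rs) (simp_all add: char_shift_commute)

section \<open>Polynomials of a matrix acting on vectors\<close>

text \<open>The vector \<open>p(C) u\<close>, computed by Horner's scheme so that induction along
  \<open>pCons\<close> applies directly.\<close>

definition poly_act :: "complex ^ 'k ^ 'k \<Rightarrow> complex poly \<Rightarrow> complex ^ 'k \<Rightarrow> complex ^ 'k::finite" where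
  "poly_act C p u = fold_coeffs (\<lambda>a w. a *s u + C *v w) p 0"

lemma poly_act_0 [simp]: "poly_act C 0 u = 0"
  by (simp add: poly_act_def)

lemma poly_act_pCons [simp]: "poly_act C (pCons a p) u = a *s u + C *v poly_act C p u"
  by (cases "a = 0 \<and> p = 0") (auto simp: poly_act_def)

lemma poly_act_add: "poly_act C (p + q) u = poly_act C p u + poly_act C q u"
  by (induction p q rule: poly_induct2)
    (simp_all add: vector_sadd_rdistrib matrix_vector_right_distrib)

lemma poly_act_smult: "poly_act C (smult c p) u = c *s poly_act C p u"
  by (induction p) (simp_all add: vector_smult_assoc vector_add_ldistrib vector_scalar_commute)

text \<open>Multiplication by a linear factor is a \<open>pCons\<close> plus a scalar multiple, so
  additivity and homogeneity in the polynomial suffice.\<close>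

lemma poly_act_linear_factor: "poly_act C ([:- r, 1:] * q) u = char_shift C r (poly_act C q u)"
proof -
  have "[:- r, 1:] * q = pCons 0 q + smult (- r) q"
    by simp
  then show ?thesis
    by (simp only: poly_act_add poly_act_smult poly_act_pCons)
      (simp add: char_shift_def vec_eq_iff)
qed

text \<open>A complex polynomial splits into linear factors: each step of the induction on the
  degree removes one root. The shifts are monic, so the leading coefficient is carried along as a
  scalar.\<close>

lemma poly_act_eq_shifts:
  assumes "p \<noteq> 0"
  shows "\<exists>rs. \<forall>u. poly_act C p u = lead_coeff p *s shifts C rs u"
  using assms
proof (induction "degree p" arbitrary: p)
  case 0
  then obtain a where "p = [:a:]" by (metis degree_eq_zeroE)
  then show ?case by (intro exI[of _ "[]"]) simp
next
  case (Suc n)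
  have "\<not> constant (poly p)" using Suc.hyps(2) by (simp add: constant_degree)
  then obtain r where "poly p r = 0" using fundamental_theorem_of_algebra by blast
  then obtain q where p: "p = [:- r, 1:] * q" by (metis dvdE poly_eq_0_iff_dvd)
  have "q \<noteq> 0" using \<open>p \<noteq> 0\<close> p by (metis mult_zero_right)
  then have "degree p = Suc (degree q)" unfolding p by (subst degree_mult_eq) auto
  with Suc.hyps(2) have "n = degree q" by simp
  from Suc.hyps(1)[OF this \<open>q \<noteq> 0\<close>]
  obtain rs where rs: "\<And>u. poly_act C q u = lead_coeff q *s shifts C rs u" by blast
  have lc: "lead_coeff p = lead_coeff q" unfolding p by (subst lead_coeff_mult) simp
  have "poly_act C p u = lead_coeff p *s shifts C (r # rs) u" for u
    unfolding lc unfolding p poly_act_linear_factor rs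
    by (simp add: char_shift_scale)
  then show ?case by blast
qed

fun mat_pow :: "complex ^ 'k ^ 'k \<Rightarrow> nat \<Rightarrow> complex ^ 'k ^ 'k::finite" where
  "mat_pow C 0 = mat 1" | "mat_pow C (Suc n) = C ** mat_pow C n"

text \<open>The offset \<open>k\<close> is there for the induction: removing the head of the
  coefficient list moves all indices by one.\<close>

lemma poly_act_Poly_map:
  "poly_act C (Poly (map (\<lambda>i. a (k + i)) [0..<n])) u = (\<Sum>i<n. a (k + i) *s (mat_pow C i *v u))"
proof (induction n arbitrary: k)
  case (Suc n)
  have "map (\<lambda>i. a (k + i)) [0..<Suc n] = a k # map (\<lambda>i. a (Suc k + i)) [0..<n]"
    by (rule nth_equalityI) (auto simp: nth_Cons' simp del: upt_Suc)
  moreover have "C *v (\<Sum>i<n. a (Suc k + i) *s (mat_pow C i *v u)) =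
      (\<Sum>i<n. a (k + Suc i) *s (mat_pow C (Suc i) *v u))"
    by (simp add: linear_sum[OF bounded_linear.linear[OF matrix_vector_mul_bounded_linear]]
        vector_scalar_commute matrix_vector_mul_assoc)
  ultimately show ?case
    by (simp only: Poly.simps poly_act_pCons Suc.IH sum.lessThan_Suc_shift) simp
qed simp

section \<open>Annihilating products of shifts\<close>

text \<open>The relation is indexed by numbers and not by vectors since powers of a matrix may
  coincide. If \<open>g\<close> is injective on the indices, its image is too large to be
  independent; otherwise a repetition gives the coefficients 1 and -1.\<close>

lemma finite_dim_linear_relation:
  fixes g :: "nat \<Rightarrow> 'a::euclidean_space"
  shows "\<exists>a. (\<exists>i\<le>DIM('a). a i \<noteq> 0) \<and> (\<Sum>i\<le>DIM('a). a i *\<^sub>R g i) = 0"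
proof (cases "inj_on g {..DIM('a)}")
  case True
  then have "dependent (g ` {..DIM('a)})"
    by (intro dependent_biggerset) (simp add: card_image)
  then obtain c where c: "(\<exists>v\<in>g ` {..DIM('a)}. c v \<noteq> 0) \<and> (\<Sum>v\<in>g ` {..DIM('a)}. c v *\<^sub>R v) = 0"
    using dependent_finite[of "g ` {..DIM('a)}"] by auto
  with True show ?thesis
    by (intro exI[of _ "c \<circ> g"]) (auto simp: sum.reindex)
next
  case False
  then obtain i j where ij: "i \<le> DIM('a)" "j \<le> DIM('a)" "i \<noteq> j" "g i = g j"
    by (auto simp: inj_on_def)
  define a where "a l = (if l = i then 1 else 0) - (if l = j then 1 else (0::real))" for l
  have "(\<Sum>l\<le>DIM('a). a l *\<^sub>R g l) = 0"
    using ij by (simp add: a_def scaleR_diff_left sum_subtractf if_distrib[of "\<lambda>x. x *\<^sub>R _"] sum.delta cong: if_cong)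
  moreover have "a i \<noteq> 0" using ij by (simp add: a_def)
  ultimately show ?thesis using ij by blast
qed

text \<open>Complex matrices form a finite-dimensional real space, so the powers of \<open>C\<close>
  satisfy a nontrivial linear relation with real coefficients. The resulting nonzero polynomial
  annihilates every vector and splits into shifts.\<close>

lemma annihilating_shifts: "\<exists>rs. \<forall>u. shifts C rs u = 0"
proof -
  let ?N = "DIM(complex ^ 'a ^ 'a)"
  obtain a where a: "\<exists>i\<le>?N. a i \<noteq> 0" "(\<Sum>i\<le>?N. a i *\<^sub>R mat_pow C i) = 0"
    using finite_dim_linear_relation[of "mat_pow C"] by blast
  \<comment> \<open>The index is written \<open>0 + i\<close> to match
    \<open>poly_act_Poly_map\<close> with offset 0.\<close>
  define p where "p = Poly (map (\<lambda>i. complex_of_real (a (0 + i))) [0..<Suc ?N])"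
  have "poly_act C p u = (\<Sum>i\<le>?N. a i *\<^sub>R mat_pow C i) *v u" for u
    unfolding p_def poly_act_Poly_map[where a = "\<lambda>i. complex_of_real (a i)"] lessThan_Suc_atMost
    by (simp add: vec_eq_iff matrix_vector_mult_def sum_distrib_left sum_distrib_right scaleR_conv_of_real[where 'a = complex] mult_ac)
       (auto intro: sum.swap)
  then have p: "poly_act C p u = 0" for u unfolding a(2) by simp
  have "p \<noteq> 0"
  proof
    assume "p = 0"
    obtain i where i: "i \<le> ?N" "a i \<noteq> 0" using a by blast
    then have "coeff p i = of_real (a i)"
      by (simp add: p_def coeff_Poly_eq nth_default_def del: upt_Suc)
    with \<open>p = 0\<close> i show False by simp
  qed
  then obtain rs where "\<And>u. poly_act C p u = lead_coeff p *s shifts C rs u"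
    using poly_act_eq_shifts by blast
  with p \<open>p \<noteq> 0\<close> show ?thesis by (metis leading_coeff_0_iff vector_mul_eq_0)
qed

text \<open>In an annihilating list of least length every entry is an eigenvalue: if
  \<open>r\<close> were none, the shift by \<open>r\<close> would be injective and, as the factors
  commute, could be dropped.\<close>

lemma annihilating_eigenvalue_shifts:
  "\<exists>rs. (\<forall>u. shifts C rs u = 0) \<and> (\<forall>r\<in>set rs. \<exists>v. v \<noteq> 0 \<and> C *v v = r *s v)"
proof -
  obtain rs where rs: "\<forall>u. shifts C rs u = 0"
    and least: "\<And>rs'. \<forall>u. shifts C rs' u = 0 \<Longrightarrow> length rs \<le> length rs'"
    using ex_has_least_nat[of "\<lambda>rs. \<forall>u. shifts C rs u = 0" _ length] annihilating_shifts by blast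
  have "\<exists>v. v \<noteq> 0 \<and> C *v v = r *s v" if r: "r \<in> set rs" for r
  proof (rule ccontr)
    assume no: "\<not> ?thesis"
    obtain as bs where split: "rs = as @ r # bs" using r by (meson split_list)
    have "shifts C (as @ bs) u = 0" for u
    proof -
      have "char_shift C r (shifts C (as @ bs) u) = shifts C rs u"
        by (simp add: split shifts_append shifts_char_shift)
      with rs no show ?thesis by (auto simp: char_shift_def)
    qed
    with least[of "as @ bs"] split show False by simp
  qed
  with rs show ?thesis by blast
qed

section \<open>Quadratic forms built from the shifts\<close>

lemma bounded_bilinear_add:
  assumes "bounded_bilinear f" "bounded_bilinear g"
  shows "bounded_bilinear (\<lambda>x y. f x y + g x y)"
proof -
  interpret f: bounded_bilinear f by fact
  interpret g: bounded_bilinear g by fact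
  obtain K where K: "\<And>x y. norm (f x y) \<le> norm x * norm y * K" using f.bounded by blast
  obtain L where L: "\<And>x y. norm (g x y) \<le> norm x * norm y * L" using g.bounded by blast
  show ?thesis
  proof (unfold_locales)
    have "norm (f x y + g x y) \<le> norm x * norm y * (K + L)" for x y
      using norm_triangle_le[OF add_mono[OF K L]] by (simp add: distrib_left)
    then show "\<exists>K. \<forall>x y. norm (f x y + g x y) \<le> norm x * norm y * K" by blast
  qed (simp_all add: f.add_left f.add_right g.add_left g.add_right
      f.scaleR_left f.scaleR_right g.scaleR_left g.scaleR_right algebra_simps)
qed

text \<open>Induction on the list. On the kernel of the longer product, the shift \<open>S\<close>
  by the new \<open>r\<close> maps into the kernel of the shorter one, where the form
  \<open>P\<close> already decays. The cross term between \<open>u\<close> and \<open>S u\<close> is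
  absorbed by a large enough weight on \<open>P\<close>. The decay is claimed on the kernel, but the
  form is defined on the whole space.\<close>

lemma shifts_lyapunov:
  assumes "\<forall>r\<in>set rs. Re r < 0"
  shows "\<exists>P \<kappa>. bounded_bilinear P \<and> (\<forall>u v. P u v = P v u) \<and> (\<forall>u. (norm u)\<^sup>2 \<le> P u u) \<and> \<kappa> > 0 \<and>
    (\<forall>u. shifts C rs u = 0 \<longrightarrow> P u (C *v u) \<le> - \<kappa> * P u u)"
  using assms
proof (induction rs)
  case Nil
  show ?case
    \<comment> \<open>For the empty list the condition reads \<open>u = 0\<close>, so any rate would
      do.\<close>
    by (intro exI[of _ inner] exI[of _ 1] conjI bounded_bilinear_inner)
      (auto simp: inner_commute power2_norm_eq_inner)
next
  case (Cons r rs)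
  then obtain P \<kappa> where P: "bounded_bilinear P" and sym: "\<And>u v. P u v = P v u"
    and pos: "\<And>u. (norm u)\<^sup>2 \<le> P u u" and \<kappa>: "\<kappa> > 0"
    and neg: "\<And>u. shifts C rs u = 0 \<Longrightarrow> P u (C *v u) \<le> - \<kappa> * P u u"
    by force
  define d where "d = - Re r"
  have "d > 0" using Cons.prems by (simp add: d_def)
  \<comment> \<open>With this weight the part \<open>1 / (2 * d)\<close> times the squared norm of
    \<open>S u\<close>, left by the cross term, uses up half of the decay of
    \<open>w * P (S u) (S u)\<close>. The other part uses up half of the decay of the squared norm
    of \<open>u\<close>. This explains the final rate
    \<open>min (d / 2) (\<kappa> / 2)\<close>.\<close>
  define w where "w = 1 / (d * \<kappa>)"
  have "w > 0" using \<open>d > 0\<close> \<kappa> by (simp add: w_def)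
  define S where "S = char_shift C r"
  have S: "bounded_linear S"
    unfolding linear_conv_bounded_linear[symmetric] S_def
    by (rule linearI)
      (simp_all add: char_shift_def linear_add[OF bounded_linear.linear[OF matrix_vector_mul_bounded_linear]]
        linear_scale[OF bounded_linear.linear[OF matrix_vector_mul_bounded_linear]] vec_eq_iff algebra_simps)
  define Q where "Q u v = inner u v + w * P (S u) (S v)" for u v
  have "bounded_bilinear (\<lambda>u v. P (S u) (w *\<^sub>R S v))"
    by (intro bounded_bilinear.comp[OF P] S bounded_linear_compose[OF bounded_linear_scaleR_right S, unfolded o_def])
  then have "bounded_bilinear (\<lambda>u v. w * P (S u) (S v))"
    by (simp add: bounded_bilinear.scaleR_right[OF P])
  then have "bounded_bilinear Q"
    unfolding Q_def by (intro bounded_bilinear_add bounded_bilinear_inner)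
  moreover have "Q u v = Q v u" for u v
    by (simp add: Q_def inner_commute sym)
  moreover have "(norm u)\<^sup>2 \<le> Q u u" for u
    using pos[of "S u"] \<open>w > 0\<close> by (simp add: Q_def power2_norm_eq_inner order_trans[OF inner_ge_zero])
  moreover have "Q u (C *v u) \<le> - min (d / 2) (\<kappa> / 2) * Q u u" if "shifts C (r # rs) u = 0" for u
  proof -
    have C: "C *v u = r *s u + S u" by (simp add: S_def char_shift_def)
    \<comment> \<open>The inner product is the real one on complex vectors, so the imaginary part of
      \<open>r\<close>, a rotation, contributes nothing.\<close>
    have "inner u (r *s u) = - d * (norm u)\<^sup>2"
      unfolding power2_norm_eq_inner
      by (simp add: inner_vec_def d_def sum_distrib_left inner_complex_def algebra_simps flip: sum_negf)
    moreover have "inner u (S u) \<le> d / 2 * (norm u)\<^sup>2 + 1 / (2 * d) * (norm (S u))\<^sup>2"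
    proof -
      have "2 * d * (norm u * norm (S u)) \<le> d\<^sup>2 * (norm u)\<^sup>2 + (norm (S u))\<^sup>2"
        using zero_le_power2[of "d * norm u - norm (S u)"]
        by (simp add: power2_diff power_mult_distrib)
      then have "norm u * norm (S u) \<le> d / 2 * (norm u)\<^sup>2 + 1 / (2 * d) * (norm (S u))\<^sup>2"
        using \<open>d > 0\<close> by (simp add: field_simps power2_eq_square)
      then show ?thesis using norm_cauchy_schwarz[of u "S u"] by linarith
    qed
    moreover have "1 / (2 * d) * (norm (S u))\<^sup>2 \<le> w * \<kappa> / 2 * P (S u) (S u)"
      using pos[of "S u"] \<open>d > 0\<close> \<kappa> by (simp add: w_def field_simps)
    moreover have "w * P (S u) (S (C *v u)) \<le> - (w * \<kappa>) * P (S u) (S u)"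
    proof -
      have "S (C *v u) = C *v S u"
        by (simp add: S_def char_shift_def matrix_vector_mult_diff_distrib vector_scalar_commute)
      moreover have "shifts C rs (S u) = 0"
        using that by (simp add: S_def shifts_char_shift)
      ultimately show ?thesis
        using mult_left_mono[OF neg[of "S u"], of w] \<open>w > 0\<close> by (simp add: mult_ac)
    qed
    moreover have "Q u (C *v u) = inner u (r *s u) + inner u (S u) + w * P (S u) (S (C *v u))"
      by (simp add: Q_def C inner_add_right)
    ultimately have "Q u (C *v u) \<le> - (d / 2) * (norm u)\<^sup>2 - w * \<kappa> / 2 * P (S u) (S u)"
      by linarith
    also have "\<dots> = - (d / 2) * (norm u)\<^sup>2 - \<kappa> / 2 * (w * P (S u) (S u))"
      by simp
    also have "\<dots> \<le> - min (d / 2) (\<kappa> / 2) * (norm u)\<^sup>2 - min (d / 2) (\<kappa> / 2) * (w * P (S u) (S u))"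
    proof -
      have "0 \<le> w * P (S u) (S u)"
        using pos[of "S u"] \<open>w > 0\<close> by (meson mult_nonneg_nonneg less_imp_le order_trans zero_le_power2)
      then show ?thesis
        by (intro diff_mono mult_right_mono) auto
    qed
    finally show ?thesis by (simp add: Q_def power2_norm_eq_inner algebra_simps)
  qed
  moreover have "min (d / 2) (\<kappa> / 2) > 0" using \<open>d > 0\<close> \<kappa> by simp
  ultimately show ?case by blast
qed

text \<open>The form for the complexified matrix is pulled back along the embedding \<open>E\<close>
  of the real vectors, which is isometric and intertwines \<open>B\<close> with its
  complexification.\<close>

theorem hurwitz_lyapunov:
  fixes B :: "real ^ 'k ^ 'k::finite"
  assumes "\<forall>\<mu>\<in>cspectrum B. Re \<mu> < 0"
  shows "\<exists>P \<kappa>. bounded_bilinear P \<and> (\<forall>u v. P u v = P v u) \<and> (\<forall>u. (norm u)\<^sup>2 \<le> P u u) \<and> \<kappa> > 0 \<and>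
    (\<forall>u. P u (B *v u) \<le> - \<kappa> * P u u)"
proof -
  let ?C = "map_matrix complex_of_real B"
  obtain rs where rs: "\<forall>u. shifts ?C rs u = 0" "\<forall>r\<in>set rs. \<exists>v. v \<noteq> 0 \<and> ?C *v v = r *s v"
    using annihilating_eigenvalue_shifts by blast
  then have "\<forall>r\<in>set rs. Re r < 0"
    using assms by (auto simp: cspectrum_def)
  from shifts_lyapunov[OF this, of ?C] rs(1) obtain P \<kappa> where P: "bounded_bilinear P"
    and sym: "\<And>u v. P u v = P v u" and pos: "\<And>u. (norm u)\<^sup>2 \<le> P u u" and \<kappa>: "\<kappa> > 0"
    and neg: "\<And>u. P u (?C *v u) \<le> - \<kappa> * P u u"
    by blast
  define E :: "real ^ 'k \<Rightarrow> complex ^ 'k" where "E v = (\<chi> i. complex_of_real (v $ i))" for v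
  have "linear E"
    by (rule linearI) (simp_all add: E_def vec_eq_iff scaleR_conv_of_real[where 'a = complex])
  then have E: "bounded_linear E" by (simp add: linear_conv_bounded_linear)
  have norm_E: "norm (E v) = norm v" for v
    by (simp add: E_def norm_vec_def)
  have "E (B *v v) = ?C *v E v" for v
    by (simp add: E_def vec_eq_iff matrix_vector_mult_def)
  then have "P (E u) (E (B *v u)) \<le> - \<kappa> * P (E u) (E u)" for u
    using neg by simp
  moreover have "(norm u)\<^sup>2 \<le> P (E u) (E u)" for u
    using pos[of "E u"] by (simp add: norm_E)
  ultimately show ?thesis
    using bounded_bilinear.comp[OF P E E] sym \<kappa> by (intro exI[of _ "\<lambda>u v. P (E u) (E v)"] exI[of _ \<kappa>]) simp
qed

section \<open>Second order calculus\<close>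

lemma has_vector_derivative_along_line:
  fixes g :: "'a::real_normed_vector \<Rightarrow> 'b::real_normed_vector"
  assumes "(g has_derivative g') (at (p + s *\<^sub>R v))"
  shows "((\<lambda>s. g (p + s *\<^sub>R v)) has_vector_derivative g' v) (at s)"
proof -
  have "((\<lambda>s. p + s *\<^sub>R v) has_derivative (\<lambda>x. x *\<^sub>R v)) (at s)"
    by (auto intro!: derivative_eq_intros)
  from has_derivative_compose[OF this assms] show ?thesis
    by (simp add: has_vector_derivative_def linear_scale[OF has_derivative_linear[OF assms]])
qed

text \<open>The mean value theorem in direction \<open>v\<close>, applied to an increment in
  direction \<open>u\<close>, reduces the second difference to two values of the gradient
  \<open>g\<close> near \<open>z\<close>. Both are expanded to first order at
  \<open>z\<close>.\<close>

lemma second_difference: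
  fixes f :: "'a::real_inner \<Rightarrow> real"
  assumes f: "\<And>x. (f has_derivative (\<lambda>h. inner (g x) h)) (at x)"
    and g: "(g has_derivative g') (at z)" and "\<eta> > 0"
  shows "\<exists>\<delta>>0. \<forall>t. 0 < t \<and> t < \<delta> \<longrightarrow>
    \<bar>f (z + t *\<^sub>R u + t *\<^sub>R v) - f (z + t *\<^sub>R u) - f (z + t *\<^sub>R v) + f z - t\<^sup>2 * inner (g' u) v\<bar>
      \<le> t\<^sup>2 * (\<eta> * (norm u + 2 * norm v) * norm v)"
proof -
  interpret g': bounded_linear g' by (rule has_derivative_bounded_linear[OF g])
  obtain d where d: "d > 0"
    "\<And>y. norm (y - z) < d \<Longrightarrow> norm (g y - g z - g' (y - z)) \<le> \<eta> * norm (y - z)"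
    using g \<open>\<eta> > 0\<close> unfolding has_derivative_at_alt by blast
  \<comment> \<open>All points that occur then lie within \<open>d\<close> of \<open>z\<close>; the
    summand 1 covers the case that both directions vanish.\<close>
  define \<delta> where "\<delta> = d / (norm u + norm v + 1)"
  have k: "norm u + norm v + 1 > 0" by (simp add: add_nonneg_pos)
  have "\<delta> > 0" using d(1) k by (simp add: \<delta>_def)
  moreover have "\<bar>f (z + t *\<^sub>R u + t *\<^sub>R v) - f (z + t *\<^sub>R u) - f (z + t *\<^sub>R v) + f z - t\<^sup>2 * inner (g' u) v\<bar>
      \<le> t\<^sup>2 * (\<eta> * (norm u + 2 * norm v) * norm v)" if "0 < t" "t < \<delta>" for t
  proof -
    define \<phi> where "\<phi> s = f (z + t *\<^sub>R u + s *\<^sub>R v) - f (z + s *\<^sub>R v)" for s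
    have "(\<phi> has_real_derivative inner (g (z + t *\<^sub>R u + s *\<^sub>R v)) v - inner (g (z + s *\<^sub>R v)) v) (at s)" for s
      unfolding \<phi>_def has_real_derivative_iff_has_vector_derivative
      by (intro has_vector_derivative_diff has_vector_derivative_along_line f)
    from MVT2[OF \<open>0 < t\<close> this]
    obtain \<xi> where \<xi>: "0 < \<xi>" "\<xi> < t"
      "\<phi> t - \<phi> 0 = (t - 0) * (inner (g (z + t *\<^sub>R u + \<xi> *\<^sub>R v)) v - inner (g (z + \<xi> *\<^sub>R v)) v)"
      by blast
    have small: "t * (norm u + norm v) < d"
    proof -
      have "t * (norm u + norm v) \<le> t * (norm u + norm v + 1)" using \<open>0 < t\<close> by simp
      also have "\<dots> < d" using that k by (simp add: \<delta>_def field_simps)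
      finally show ?thesis .
    qed
    have "\<xi> * norm v \<le> t * norm v" using \<xi> by (intro mult_right_mono) auto
    then have n1: "norm (t *\<^sub>R u + \<xi> *\<^sub>R v) \<le> t * (norm u + norm v)"
      using \<open>0 < t\<close> \<xi> norm_triangle_ineq[of "t *\<^sub>R u" "\<xi> *\<^sub>R v"] by (simp add: distrib_left)
    have n2: "norm (\<xi> *\<^sub>R v) \<le> t * norm v" using \<open>\<xi> * norm v \<le> t * norm v\<close> \<xi> by simp
    have "t * norm v \<le> t * (norm u + norm v)" using \<open>0 < t\<close> by simp
    \<comment> \<open>In the difference of the two expansions \<open>g z\<close> and the term in
      \<open>\<xi>\<close> cancel. What remains is \<open>t *\<^sub>R g' u\<close> and the
      remainders.\<close>
    define R1 where "R1 = g (z + t *\<^sub>R u + \<xi> *\<^sub>R v) - g z - g' (t *\<^sub>R u + \<xi> *\<^sub>R v)"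
    define R2 where "R2 = g (z + \<xi> *\<^sub>R v) - g z - g' (\<xi> *\<^sub>R v)"
    have "norm R1 \<le> \<eta> * norm (t *\<^sub>R u + \<xi> *\<^sub>R v)"
      using d(2)[of "z + t *\<^sub>R u + \<xi> *\<^sub>R v"] n1 small by (simp add: R1_def add.assoc)
    also have "\<dots> \<le> \<eta> * (t * (norm u + norm v))" using n1 \<open>\<eta> > 0\<close> by simp
    finally have R1: "norm R1 \<le> \<eta> * (t * (norm u + norm v))" .
    have "norm R2 \<le> \<eta> * norm (\<xi> *\<^sub>R v)"
      using d(2)[of "z + \<xi> *\<^sub>R v"] n2 small \<open>t * norm v \<le> t * (norm u + norm v)\<close> by (simp add: R2_def)
    also have "\<dots> \<le> \<eta> * (t * norm v)" using n2 \<open>\<eta> > 0\<close> by simp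
    finally have R2: "norm R2 \<le> \<eta> * (t * norm v)" .
    have R: "norm (R1 - R2) \<le> t * (\<eta> * (norm u + 2 * norm v))"
      using norm_triangle_ineq4[of R1 R2] R1 R2 by (simp add: algebra_simps)
    have "g (z + t *\<^sub>R u + \<xi> *\<^sub>R v) - g (z + \<xi> *\<^sub>R v) = t *\<^sub>R g' u + (R1 - R2)"
      by (simp add: R1_def R2_def g'.add g'.scaleR)
    then have "\<phi> t - \<phi> 0 = t * inner (t *\<^sub>R g' u + (R1 - R2)) v"
      using \<xi>(3) by (simp flip: inner_diff_left)
    then have "\<phi> t - \<phi> 0 - t\<^sup>2 * inner (g' u) v = t * inner (R1 - R2) v"
      by (simp add: inner_add_left power2_eq_square algebra_simps)
    also have "\<bar>\<dots>\<bar> \<le> t * (norm (R1 - R2) * norm v)"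
      using \<open>0 < t\<close> Cauchy_Schwarz_ineq2[of "R1 - R2" v] by (simp add: abs_mult)
    also have "\<dots> \<le> t * (t * (\<eta> * (norm u + 2 * norm v)) * norm v)"
      using \<open>0 < t\<close> R by (intro mult_left_mono mult_right_mono) auto
    finally show ?thesis by (simp add: \<phi>_def power2_eq_square algebra_simps)
  qed
  ultimately show ?thesis by blast
qed

text \<open>The second difference is symmetric in \<open>u\<close> and \<open>v\<close>, so the two
  inner products, being its limits after division by the square of \<open>t\<close>, agree.\<close>

lemma second_derivative_symmetric:
  fixes f :: "'a::real_inner \<Rightarrow> real"
  assumes f: "\<And>x. (f has_derivative (\<lambda>h. inner (g x) h)) (at x)"
    and g: "(g has_derivative g') (at z)"
  shows "inner (g' u) v = inner (g' v) u"
proof -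
  define K where "K = (norm u + 2 * norm v) * norm v + (norm v + 2 * norm u) * norm u"
  have "K \<ge> 0" by (simp add: K_def)
  have bound: "\<bar>inner (g' u) v - inner (g' v) u\<bar> \<le> \<eta> * K" if \<eta>: "\<eta> > 0" for \<eta>
  proof -
    obtain \<delta>1 where \<delta>1: "\<delta>1 > 0" "\<And>t. 0 < t \<and> t < \<delta>1 \<Longrightarrow>
      \<bar>f (z + t *\<^sub>R u + t *\<^sub>R v) - f (z + t *\<^sub>R u) - f (z + t *\<^sub>R v) + f z - t\<^sup>2 * inner (g' u) v\<bar>
        \<le> t\<^sup>2 * (\<eta> * (norm u + 2 * norm v) * norm v)"
      using second_difference[OF f g \<eta>, of u v] by blast
    obtain \<delta>2 where \<delta>2: "\<delta>2 > 0" "\<And>t. 0 < t \<and> t < \<delta>2 \<Longrightarrow>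
      \<bar>f (z + t *\<^sub>R v + t *\<^sub>R u) - f (z + t *\<^sub>R v) - f (z + t *\<^sub>R u) + f z - t\<^sup>2 * inner (g' v) u\<bar>
        \<le> t\<^sup>2 * (\<eta> * (norm v + 2 * norm u) * norm u)"
      using second_difference[OF f g \<eta>, of v u] by blast
    define t where "t = min \<delta>1 \<delta>2 / 2"
    have t: "0 < t" "t < \<delta>1" "t < \<delta>2" using \<delta>1(1) \<delta>2(1) by (auto simp: t_def)
    have swap: "z + t *\<^sub>R v + t *\<^sub>R u = z + t *\<^sub>R u + t *\<^sub>R v" by simp
    have "\<bar>t\<^sup>2 * inner (g' u) v - t\<^sup>2 * inner (g' v) u\<bar> \<le>
        t\<^sup>2 * (\<eta> * (norm u + 2 * norm v) * norm v) + t\<^sup>2 * (\<eta> * (norm v + 2 * norm u) * norm u)"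
      using \<delta>1(2)[of t] \<delta>2(2)[of t, unfolded swap] t by linarith
    also have "\<dots> = t\<^sup>2 * (\<eta> * K)" by (simp add: K_def algebra_simps)
    finally have "t\<^sup>2 * \<bar>inner (g' u) v - inner (g' v) u\<bar> \<le> t\<^sup>2 * (\<eta> * K)"
      by (simp add: abs_mult flip: right_diff_distrib)
    then show ?thesis using t by simp
  qed
  have "\<bar>inner (g' u) v - inner (g' v) u\<bar> \<le> 0"
  proof (rule field_le_epsilon)
    fix e :: real assume "e > 0"
    have "\<bar>inner (g' u) v - inner (g' v) u\<bar> \<le> e / (K + 1) * K"
      using \<open>e > 0\<close> \<open>K \<ge> 0\<close> by (intro bound) simp
    also have "\<dots> \<le> e" using \<open>e > 0\<close> \<open>K \<ge> 0\<close> by (simp add: field_simps)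
    finally show "\<bar>inner (g' u) v - inner (g' v) u\<bar> \<le> 0 + e" by simp
  qed
  then show ?thesis by simp
qed

text \<open>If the second derivative were negative, the slope would be negative just to the right of
  0, and the mean value theorem would give a value below the minimum.\<close>

lemma local_min_along_line:
  fixes f :: "'a::real_inner \<Rightarrow> real"
  assumes f: "\<And>x. (f has_derivative (\<lambda>h. inner (g x) h)) (at x)"
    and g: "(g has_derivative g') (at z)"
    and min: "\<forall>\<^sub>F t in nhds 0. f z \<le> f (z + t *\<^sub>R u)"
  shows "inner (g z) u = 0" and "0 \<le> inner (g' u) u"
proof -
  define \<phi> where "\<phi> t = f (z + t *\<^sub>R u)" for t
  have \<phi>: "(\<phi> has_real_derivative inner (g (z + t *\<^sub>R u)) u) (at t)" for t
    unfolding \<phi>_def has_real_derivative_iff_has_vector_derivative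
    by (intro has_vector_derivative_along_line f)
  obtain d where d: "d > 0" "\<And>t. \<bar>t\<bar> < d \<Longrightarrow> \<phi> 0 \<le> \<phi> t"
    using min unfolding eventually_nhds_metric by (auto simp: \<phi>_def dist_real_def)
  show crit: "inner (g z) u = 0"
    using DERIV_local_min[OF \<phi>[of 0] d(1)] d(2) by auto
  show "0 \<le> inner (g' u) u"
  proof (rule ccontr)
    assume neg: "\<not> 0 \<le> inner (g' u) u"
    have "((\<lambda>t. g (z + t *\<^sub>R u)) has_vector_derivative g' u) (at 0)"
      by (rule has_vector_derivative_along_line) (simp add: g)
    from bounded_linear.has_vector_derivative[OF bounded_linear_inner_left this, of u]
    have "((\<lambda>t. inner (g (z + t *\<^sub>R u)) u) has_real_derivative inner (g' u) u) (at 0)"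
      by (simp add: has_real_derivative_iff_has_vector_derivative)
    from DERIV_neg_dec_right[OF this] neg crit
    obtain e where e: "e > 0" "\<And>h. 0 < h \<Longrightarrow> h < e \<Longrightarrow> inner (g (z + h *\<^sub>R u)) u < 0"
      by auto
    define t where "t = min d e / 2"
    have t: "0 < t" "t < d" "t < e" using d(1) e(1) by (auto simp: t_def)
    obtain \<xi> where "0 < \<xi>" "\<xi> < t" "\<phi> t - \<phi> 0 = (t - 0) * inner (g (z + \<xi> *\<^sub>R u)) u"
      using MVT2[OF \<open>0 < t\<close> \<phi>] by blast
    with e(2)[of \<xi>] t have "\<phi> t < \<phi> 0"
      using mult_pos_neg[of t "inner (g (z + \<xi> *\<^sub>R u)) u"] by simp
    with d(2)[of t] t show False by simp
  qed
qed

text \<open>The difference quotient over a short step along \<open>u\<close> is bounded by the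
  Lipschitz constant and lies arbitrarily close to \<open>g' u\<close>.\<close>

lemma lipschitz_derivative_norm_le:
  fixes g :: "'a::real_normed_vector \<Rightarrow> 'b::real_normed_vector"
  assumes lip: "L-lipschitz_on UNIV g" and g: "(g has_derivative g') (at z)"
  shows "norm (g' u) \<le> L * norm u"
proof (rule field_le_epsilon)
  fix e :: real assume "e > 0"
  define \<eta> where "\<eta> = e / (norm u + 1)"
  have k: "norm u + 1 > 0" by (simp add: add_nonneg_pos)
  have "\<eta> > 0" using \<open>e > 0\<close> k by (simp add: \<eta>_def)
  then obtain d where d: "d > 0"
    "\<And>y. norm (y - z) < d \<Longrightarrow> norm (g y - g z - g' (y - z)) \<le> \<eta> * norm (y - z)"
    using g unfolding has_derivative_at_alt by blast
  define s where "s = d / (norm u + 1)"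
  have "s > 0" using d(1) k by (simp add: s_def)
  have "s * norm u < d" using d(1) k by (simp add: s_def field_simps)
  then have "norm (g (z + s *\<^sub>R u) - g z - s *\<^sub>R g' u) \<le> \<eta> * (s * norm u)"
    using d(2)[of "z + s *\<^sub>R u"] \<open>s > 0\<close> linear_scale[OF has_derivative_linear[OF g]] by simp
  moreover have "norm (g (z + s *\<^sub>R u) - g z) \<le> L * (s * norm u)"
    using lipschitz_onD[OF lip, of "z + s *\<^sub>R u" z] \<open>s > 0\<close> by (simp add: dist_norm)
  ultimately have "norm (s *\<^sub>R g' u) \<le> L * (s * norm u) + \<eta> * (s * norm u)"
    using norm_triangle_ineq4[of "g (z + s *\<^sub>R u) - g z" "g (z + s *\<^sub>R u) - g z - s *\<^sub>R g' u"] by simp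
  also have "\<dots> = s * (L * norm u + \<eta> * norm u)" by (simp add: algebra_simps)
  finally have "norm (g' u) \<le> L * norm u + \<eta> * norm u" using \<open>s > 0\<close> by simp
  also have "\<eta> * norm u \<le> e" using \<open>e > 0\<close> k by (simp add: \<eta>_def field_simps)
  finally show "norm (g' u) \<le> L * norm u + e" by simp
qed

text \<open>A product rule with a factor \<open>G\<close> that is merely continuous. As
  \<open>g\<close> vanishes at \<open>z\<close>, it is of first order there, so replacing
  \<open>G x\<close> by \<open>G z\<close> changes the product by a term of smaller order. It serves
  for the second field, where \<open>G\<close> is built from second derivatives of a C2
  function.\<close>

lemma has_derivative_bilinear_at_zero:
  fixes g :: "'a::real_normed_vector \<Rightarrow> 'c::real_normed_vector"
  assumes mul: "bounded_bilinear mul" and g: "(g has_derivative g') (at z)"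
    and zero: "g z = 0" and G: "isCont G z"
  shows "((\<lambda>x. mul (G x) (g x)) has_derivative (\<lambda>h. mul (G z) (g' h))) (at z)"
proof -
  interpret mul: bounded_bilinear mul by fact
  have rest: "((\<lambda>x. mul (G x - G z) (g x)) has_derivative (\<lambda>h. 0)) (at z)"
    unfolding has_derivative_at_alt
  proof (intro conjI allI impI)
    show "bounded_linear (\<lambda>h::'a. 0)" by (rule bounded_linear_zero)
    fix e :: real assume "e > 0"
    obtain K where K: "K > 0" "\<And>a b. norm (mul a b) \<le> norm a * norm b * K"
      using mul.pos_bounded by blast
    obtain M where M: "M > 0" "\<And>h. norm (g' h) \<le> norm h * M"
      using bounded_linear.pos_bounded[OF has_derivative_bounded_linear[OF g]] by blast
    obtain d1 where d1: "d1 > 0" "\<And>y. norm (y - z) < d1 \<Longrightarrow> norm (g y - g z - g' (y - z)) \<le> 1 * norm (y - z)"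
      using g unfolding has_derivative_at_alt by (meson zero_less_one)
    \<comment> \<open>Near \<open>z\<close> the norm of \<open>g y\<close> is at most
      \<open>M + 1\<close> times the distance and \<open>mul\<close> contributes \<open>K\<close>;
      this tolerance turns the product into \<open>e\<close>.\<close>
    have "e / ((M + 1) * K) > 0" using \<open>e > 0\<close> K M by simp
    then obtain d2 where d2: "d2 > 0" "\<And>y. norm (y - z) < d2 \<Longrightarrow> norm (G y - G z) < e / ((M + 1) * K)"
      using G unfolding continuous_at_eps_delta dist_norm by blast
    have "norm (mul (G y - G z) (g y)) \<le> e * norm (y - z)" if "norm (y - z) < min d1 d2" for y
    proof -
      have "norm (g y) \<le> norm (g' (y - z)) + norm (g y - g z - g' (y - z))"
        using norm_triangle_ineq[of "g' (y - z)" "g y - g z - g' (y - z)"] by (simp add: zero)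
      also have "\<dots> \<le> (M + 1) * norm (y - z)"
        using M(2)[of "y - z"] d1(2)[of y] that by (simp add: algebra_simps)
      finally have "norm (g y) \<le> (M + 1) * norm (y - z)" .
      then have "norm (G y - G z) * norm (g y) * K \<le> e / ((M + 1) * K) * ((M + 1) * norm (y - z)) * K"
        using d2(2)[of y] that K(1) \<open>e / ((M + 1) * K) > 0\<close> by (intro mult_right_mono mult_mono) auto
      also have "\<dots> = e * norm (y - z)" using K(1) M(1) by simp
      finally show ?thesis using K(2)[of "G y - G z" "g y"] by linarith
    qed
    then show "\<exists>d>0. \<forall>y. norm (y - z) < d \<longrightarrow>
        norm (mul (G y - G z) (g y) - mul (G z - G z) (g z) - 0) \<le> e * norm (y - z)"
      using d1(1) d2(1) by (intro exI[of _ "min d1 d2"]) (auto simp: zero mul.zero_right)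
  qed
  from has_derivative_add[OF rest bounded_linear.has_derivative[OF mul.bounded_linear_right g, of "G z"]]
  show ?thesis by (simp add: mul.diff_left)
qed

section \<open>Spectra and linearised stability\<close>

theorem hurwitz_exp_stable:
  fixes V :: "real ^ 'k::finite \<Rightarrow> real ^ 'k"
  assumes "V z = 0" and "(V has_derivative (*v) B) (at z)" and "\<forall>\<mu>\<in>cspectrum B. Re \<mu> < 0"
  shows "exp_stable_equilibrium V z"
proof -
  from hurwitz_lyapunov[OF assms(3)] obtain P \<kappa> where "bounded_bilinear P" "\<And>u v. P u v = P v u"
    "\<And>u. (norm u)\<^sup>2 \<le> P u u" "\<kappa> > 0" "\<And>u. P u (B *v u) \<le> - \<kappa> * P u u"
    by blast
  with lyapunov_exp_stable[OF assms(1,2)] show ?thesis by blast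
qed

text \<open>Real and imaginary parts of an eigenvector turn the complex equation into two real ones,
  to which estimates for real vectors apply.\<close>

lemma cspectrum_real_imag:
  assumes "\<mu> \<in> cspectrum A"
  obtains p q where "p \<noteq> 0 \<or> q \<noteq> 0"
    and "A *v p = Re \<mu> *\<^sub>R p - Im \<mu> *\<^sub>R q" and "A *v q = Re \<mu> *\<^sub>R q + Im \<mu> *\<^sub>R p"
proof -
  from assms obtain v where v: "v \<noteq> 0" "map_matrix complex_of_real A *v v = \<mu> *s v"
    unfolding cspectrum_def by blast
  define p q where "p = (\<chi> i. Re (v $ i))" and "q = (\<chi> i. Im (v $ i))"
  have comp: "(\<Sum>j\<in>UNIV. complex_of_real (A $ i $ j) * v $ j) = \<mu> * v $ i" for i
    using arg_cong[OF v(2), of "\<lambda>w. w $ i"] by (simp add: matrix_vector_mult_def)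
  show ?thesis
  proof
    show "p \<noteq> 0 \<or> q \<noteq> 0"
      using v(1) by (auto simp: p_def q_def vec_eq_iff complex_eq_iff)
    show "A *v p = Re \<mu> *\<^sub>R p - Im \<mu> *\<^sub>R q"
      using arg_cong[OF comp, of Re] by (simp add: vec_eq_iff matrix_vector_mult_def p_def q_def)
    show "A *v q = Re \<mu> *\<^sub>R q + Im \<mu> *\<^sub>R p"
      using arg_cong[OF comp, of Im] by (simp add: vec_eq_iff matrix_vector_mult_def p_def q_def)
  qed
qed

text \<open>When the squared norms of \<open>A *v p\<close> and \<open>A *v q\<close> are added, the
  mixed terms cancel and the square of \<open>cmod \<mu>\<close> factors out.\<close>

lemma cspectrum_norm_le:
  assumes bound: "\<And>u. norm (A *v u) \<le> K * norm u" and \<mu>: "\<mu> \<in> cspectrum A"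
  shows "cmod \<mu> \<le> K"
proof -
  obtain p q where pq: "p \<noteq> 0 \<or> q \<noteq> 0"
    "A *v p = Re \<mu> *\<^sub>R p - Im \<mu> *\<^sub>R q" "A *v q = Re \<mu> *\<^sub>R q + Im \<mu> *\<^sub>R p"
    using cspectrum_real_imag[OF \<mu>] by blast
  have pos: "(norm p)\<^sup>2 + (norm q)\<^sup>2 > 0"
    using pq(1) by (auto simp: add_pos_nonneg add_nonneg_pos)
  have "K \<ge> 0"
    using pq(1) order_trans[OF norm_ge_zero bound] by (metis zero_le_mult_iff norm_le_zero_iff)
  have "(cmod \<mu>)\<^sup>2 * ((norm p)\<^sup>2 + (norm q)\<^sup>2) = (norm (A *v p))\<^sup>2 + (norm (A *v q))\<^sup>2"
    unfolding pq(2,3) power2_norm_eq_inner cmod_power2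
    by (simp add: inner_simps inner_commute inner_complex_def power2_eq_square algebra_simps)
  also have "\<dots> \<le> (K * norm p)\<^sup>2 + (K * norm q)\<^sup>2"
    by (intro add_mono power_mono bound norm_ge_zero)
  also have "\<dots> = K\<^sup>2 * ((norm p)\<^sup>2 + (norm q)\<^sup>2)"
    by (simp add: power_mult_distrib algebra_simps)
  finally have "(cmod \<mu>)\<^sup>2 \<le> K\<^sup>2" using pos by simp
  then show ?thesis using \<open>K \<ge> 0\<close> by (rule power2_le_imp_le)
qed

lemma cspectrum_scaleR:
  assumes "c \<noteq> 0" and "\<mu> \<in> cspectrum (c *\<^sub>R A)"
  shows "\<exists>\<nu>\<in>cspectrum A. \<mu> = of_real c * \<nu>"
proof -
  from assms obtain v where v: "v \<noteq> 0" "map_matrix complex_of_real (c *\<^sub>R A) *v v = \<mu> *s v"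
    unfolding cspectrum_def by blast
  have "map_matrix complex_of_real (c *\<^sub>R A) *v v = of_real c *s (map_matrix complex_of_real A *v v)"
    by (simp add: vec_eq_iff matrix_vector_mult_def sum_distrib_left mult_ac)
  with v \<open>c \<noteq> 0\<close> have "map_matrix complex_of_real A *v v = (\<mu> / of_real c) *s v"
    by (simp add: vec_eq_iff field_simps)
  with v(1) \<open>c \<noteq> 0\<close> show ?thesis
    by (intro bexI[of _ "\<mu> / of_real c"]) (auto simp: cspectrum_def)
qed

text \<open>With \<open>r\<close> and \<open>r'\<close> the roots of
  \<open>k * x\<^sup>2 + x - \<mu>\<close>, an eigenvector \<open>v\<close> is annihilated by the
  product of the shifts by \<open>r\<close> and \<open>r'\<close>. Either \<open>v\<close> itself is
  an eigenvector for \<open>r'\<close>, or its shift by \<open>r'\<close> is one for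
  \<open>r\<close>.\<close>

lemma cspectrum_quadratic:
  assumes "c \<noteq> 0" and "\<mu> \<in> cspectrum (A + c *\<^sub>R (A ** A))"
  shows "\<exists>\<nu>\<in>cspectrum A. \<mu> = \<nu> + of_real c * \<nu>\<^sup>2"
proof -
  define C where "C = map_matrix complex_of_real A"
  define k where "k = complex_of_real c"
  have "k \<noteq> 0" using \<open>c \<noteq> 0\<close> by (simp add: k_def)
  from assms obtain v where v: "v \<noteq> 0" "map_matrix complex_of_real (A + c *\<^sub>R (A ** A)) *v v = \<mu> *s v"
    unfolding cspectrum_def by blast
  have mat: "map_matrix complex_of_real (A + c *\<^sub>R (A ** A)) = C + (\<chi> i. k *s ((C ** C) $ i))"
    by (simp add: C_def k_def vec_eq_iff matrix_matrix_mult_def)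
  have "(\<chi> i. k *s ((C ** C) $ i)) *v v = k *s (C *v (C *v v))"
    unfolding matrix_vector_mul_assoc
    by (simp add: vec_eq_iff matrix_vector_mult_def sum_distrib_left mult_ac)
  with v(2) have eig: "C *v v + k *s (C *v (C *v v)) = \<mu> *s v"
    unfolding mat by (simp add: matrix_vector_mult_add_rdistrib)
  \<comment> \<open>\<open>r\<close> comes from the quadratic formula, and \<open>r'\<close> from
    the sum \<open>- 1 / k\<close> of the roots.\<close>
  define r where "r = (csqrt (1 + 4 * k * \<mu>) - 1) / (2 * k)"
  define r' where "r' = - 1 / k - r"
  have sq: "(csqrt (1 + 4 * k * \<mu>))\<^sup>2 = 1 + 4 * k * \<mu>" by simp
  have "2 * k * r + 1 = csqrt (1 + 4 * k * \<mu>)" using \<open>k \<noteq> 0\<close> by (simp add: r_def)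
  then have "(2 * k * r + 1)\<^sup>2 = 1 + 4 * k * \<mu>" using sq by simp
  then have "4 * k * (r + k * r\<^sup>2) = 4 * k * \<mu>" by (simp add: power2_eq_square algebra_simps)
  then have r: "\<mu> = r + k * r\<^sup>2" using \<open>k \<noteq> 0\<close> by simp
  then have r': "\<mu> = r' + k * r'\<^sup>2"
    using \<open>k \<noteq> 0\<close> by (simp add: r'_def power2_eq_square field_simps)
  have sum: "k * (r + r') = - 1" and mul: "k * (r * r') = - \<mu>"
    using \<open>k \<noteq> 0\<close> by (simp_all add: r r'_def power2_eq_square field_simps)
  define w where "w = C *v v - r' *s v"
  have "k *s (C *v w - r *s w) = (k *s (C *v (C *v v)) - (k * (r + r')) *s (C *v v)) + (k * (r * r')) *s v"
    by (simp add: w_def matrix_vector_mult_diff_distrib vector_scalar_commute vec_eq_iff algebra_simps)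
  also have "\<dots> = 0"
    unfolding sum mul using eig by (simp add: vec_eq_iff algebra_simps)
  finally have "C *v w = r *s w"
    using \<open>k \<noteq> 0\<close> by (metis vector_mul_eq_0 eq_iff_diff_eq_0)
  show ?thesis
  proof (cases "w = 0")
    case True
    then have "C *v v = r' *s v" by (simp add: w_def)
    with v(1) r' show ?thesis
      by (intro bexI[of _ r']) (auto simp: cspectrum_def C_def k_def)
  next
    case False
    with \<open>C *v w = r *s w\<close> r show ?thesis
      by (intro bexI[of _ r]) (auto simp: cspectrum_def C_def k_def)
  qed
qed

section \<open>Saddle points\<close>

lemma has_derivative_grad:
  assumes "f differentiable (at z)"
  shows "(f has_derivative (\<lambda>h. inner (grad f z) h)) (at z)"
proof -
  have der: "(f has_derivative frechet_derivative f (at z)) (at z)"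
    using assms by (simp add: frechet_derivative_works)
  have "frechet_derivative f (at z) h = inner (grad f z) h" for h
  proof -
    have "frechet_derivative f (at z) h = frechet_derivative f (at z) (\<Sum>k\<in>UNIV. (h $ k) *\<^sub>R axis k 1)"
      using basis_expansion[of h] by (simp add: scalar_mult_eq_scaleR)
    also have "\<dots> = inner (grad f z) h"
      by (simp add: linear_sum[OF has_derivative_linear[OF der]]
          linear_scale[OF has_derivative_linear[OF der]] grad_def inner_vec_def mult.commute)
    finally show ?thesis .
  qed
  then have "frechet_derivative f (at z) = (\<lambda>h. inner (grad f z) h)" ..
  with der show ?thesis by simp
qed

lemma has_derivative_hessian:
  "grad f differentiable (at z) \<Longrightarrow> (grad f has_derivative (*v) (hessian f z)) (at z)"
  unfolding hessian_def by (simp add: jacobian_works)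

lemma hessian_symmetric:
  assumes "C2_fun f"
  shows "inner (hessian f z *v u) v = inner (hessian f z *v v) u"
  by (rule second_derivative_symmetric[where f = f and g = "grad f" and z = z])
    (use assms in \<open>auto simp: C2_fun_def intro: has_derivative_grad has_derivative_hessian\<close>)

section \<open>The sign change in the y-coordinates\<close>

text \<open>The block matrix diag(I, -I) as a map. It is a self-adjoint isometric involution
  carrying the gradient to the saddle field and the Hessian to the negative of
  \<open>H_mat\<close>.\<close>

definition flip_y :: "real ^ ('n::finite + 'm::finite) \<Rightarrow> real ^ ('n + 'm)" where
  "flip_y v = (\<chi> k. case k of Inl i \<Rightarrow> v $ Inl i | Inr j \<Rightarrow> - (v $ Inr j))"

lemma linear_flip_y: "linear flip_y"
  by (rule linearI) (auto simp: flip_y_def vec_eq_iff split: sum.split)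

lemma bounded_linear_flip_y: "bounded_linear flip_y"
  by (simp add: linear_flip_y flip: linear_conv_bounded_linear)

lemma flip_y_flip_y [simp]: "flip_y (flip_y v) = v"
  by (auto simp: flip_y_def vec_eq_iff split: sum.split)

lemma inner_flip_y_left: "inner (flip_y u) v = inner u (flip_y v)"
  by (auto simp: flip_y_def inner_vec_def intro!: sum.cong split: sum.split)

lemma norm_flip_y [simp]: "norm (flip_y v) = norm v"
  by (simp add: norm_eq_sqrt_inner inner_flip_y_left)

lemma saddle_field_flip: "saddle_field f z = flip_y (grad f z)"
  by (simp add: saddle_field_def flip_y_def)

lemma H_mat_mult:
  assumes "grad f differentiable (at z)"
  shows "H_mat f z *v u = - flip_y (hessian f z *v u)"
  by (auto simp: vec_eq_iff matrix_vector_mult_def flip_y_def H_mat_blocks[OF assms] sum_negf split: sum.split)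

lemma jacobian_saddle_field: "jacobian (saddle_field f) (at z) = - H_mat f z"
  by (simp add: H_mat_def)

lemma has_derivative_saddle_field:
  assumes "grad f differentiable (at z)"
  shows "(saddle_field f has_derivative (\<lambda>h. - (H_mat f z *v h))) (at z)"
  using bounded_linear.has_derivative[OF bounded_linear_flip_y has_derivative_hessian[OF assms]]
  by (simp add: H_mat_mult[OF assms] saddle_field_flip[abs_def])

text \<open>\<open>H_mat\<close> arises from the continuous Hessian by the linear map
  \<open>\<Phi>\<close>, which changes the sign of the x-rows.\<close>

lemma isCont_H_mat:
  assumes "C2_fun f"
  shows "isCont (H_mat f) z"
proof -
  define \<Phi> :: "real ^ ('a + 'b) ^ ('a + 'b) \<Rightarrow> real ^ ('a + 'b) ^ ('a + 'b)" where
    "\<Phi> M = (\<chi> k. case k of Inl i \<Rightarrow> - (M $ Inl i) | Inr j \<Rightarrow> M $ Inr j)" for M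
  have "linear \<Phi>"
    by (rule linearI) (auto simp: \<Phi>_def vec_eq_iff split: sum.split)
  then have "bounded_linear \<Phi>" by (simp add: linear_conv_bounded_linear)
  moreover have "isCont (hessian f) z"
    using assms by (simp add: C2_fun_def continuous_on_eq_continuous_at)
  ultimately have "isCont (\<lambda>x. \<Phi> (hessian f x)) z"
    by (rule bounded_linear.isCont)
  moreover have "H_mat f = (\<lambda>x. \<Phi> (hessian f x))"
    using assms by (auto simp: \<Phi>_def vec_eq_iff fun_eq_iff C2_fun_def H_mat_blocks split: sum.split)
  ultimately show ?thesis by simp
qed

section \<open>First and second order conditions at a saddle point\<close>

text \<open>Short lines in an x-direction or a y-direction stay in the neighbourhood and keep the
  other coordinate fixed, so one of the two saddle inequalities applies along them.\<close>

lemma saddle_point_eventually: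
  assumes "saddle_point f z"
  shows "(\<And>j. u $ Inr j = 0) \<Longrightarrow> \<forall>\<^sub>F t in nhds 0. f z \<le> f (z + t *\<^sub>R u)"
    and "(\<And>i. u $ Inl i = 0) \<Longrightarrow> \<forall>\<^sub>F t in nhds 0. f (z + t *\<^sub>R u) \<le> f z"
proof -
  obtain xs ys U where z: "z = join xs ys" and U: "open U" "z \<in> U"
    and saddle: "\<And>x y. join x y \<in> U \<Longrightarrow> f (join xs y) \<le> f z \<and> f z \<le> f (join x ys)"
    using assms unfolding saddle_point_def by metis
  have "((\<lambda>t. z + t *\<^sub>R u) \<longlongrightarrow> z + 0 *\<^sub>R u) (nhds 0)"
    by (intro tendsto_intros filterlim_ident)
  then have near: "\<forall>\<^sub>F t in nhds 0. z + t *\<^sub>R u \<in> U"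
    using U by (auto dest: topological_tendstoD)
  have split: "z + t *\<^sub>R u = join (xs + t *\<^sub>R (\<chi> i. u $ Inl i)) (ys + t *\<^sub>R (\<chi> j. u $ Inr j))" for t
    by (auto simp: z join_def vec_eq_iff split: sum.split)
  show "\<forall>\<^sub>F t in nhds 0. f z \<le> f (z + t *\<^sub>R u)" if "\<And>j. u $ Inr j = 0"
    using near
  proof eventually_elim
    case (elim t)
    have "z + t *\<^sub>R u = join (xs + t *\<^sub>R (\<chi> i. u $ Inl i)) ys"
      unfolding split using that by (auto simp: vec_eq_iff join_def split: sum.split)
    with elim saddle show ?case by metis
  qed
  show "\<forall>\<^sub>F t in nhds 0. f (z + t *\<^sub>R u) \<le> f z" if "\<And>i. u $ Inl i = 0"
    using near
  proof eventually_elim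
    case (elim t)
    have "z + t *\<^sub>R u = join xs (ys + t *\<^sub>R (\<chi> j. u $ Inr j))"
      unfolding split using that by (auto simp: vec_eq_iff join_def split: sum.split)
    with elim saddle show ?case by metis
  qed
qed

text \<open>The conditions for a minimum along a line, applied to \<open>f\<close> in x-directions
  and to \<open>- f\<close> in y-directions.\<close>

lemma saddle_point_conditions:
  assumes C2: "C2_fun f" and saddle: "saddle_point f z"
  shows "(\<And>j. u $ Inr j = 0) \<Longrightarrow> inner (grad f z) u = 0 \<and> 0 \<le> inner (hessian f z *v u) u"
    and "(\<And>i. u $ Inl i = 0) \<Longrightarrow> inner (grad f z) u = 0 \<and> inner (hessian f z *v u) u \<le> 0"
proof -
  have f: "\<And>x. (f has_derivative (\<lambda>h. inner (grad f x) h)) (at x)"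
    and g: "(grad f has_derivative (*v) (hessian f z)) (at z)"
    using C2 by (auto simp: C2_fun_def intro: has_derivative_grad has_derivative_hessian)
  show "inner (grad f z) u = 0 \<and> 0 \<le> inner (hessian f z *v u) u" if "\<And>j. u $ Inr j = 0"
    using local_min_along_line[OF f g saddle_point_eventually(1)[OF saddle that]] by blast
  have f': "((\<lambda>x. - f x) has_derivative (\<lambda>h. inner (- grad f x) h)) (at x)" for x
    using has_derivative_minus[OF f] by simp
  show "inner (grad f z) u = 0 \<and> inner (hessian f z *v u) u \<le> 0" if "\<And>i. u $ Inl i = 0"
    using local_min_along_line[OF f' has_derivative_minus[OF g], of u]
      saddle_point_eventually(2)[OF saddle that] by simp
qed

lemma saddle_point_grad:
  assumes "C2_fun f" "saddle_point f z"
  shows "grad f z = 0"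
proof -
  have "grad f z $ k = 0" for k
  proof (cases k)
    case (Inl i)
    have "(axis k 1 :: real ^ ('a + 'b)) $ Inr j = 0" for j by (simp add: Inl axis_def)
    then show ?thesis
      using saddle_point_conditions(1)[OF assms, of "axis k 1"] by (simp add: inner_axis)
  next
    case (Inr j)
    have "(axis k 1 :: real ^ ('a + 'b)) $ Inl i = 0" for i by (simp add: Inr axis_def)
    then show ?thesis
      using saddle_point_conditions(2)[OF assms, of "axis k 1"] by (simp add: inner_axis)
  qed
  then show ?thesis by (simp add: vec_eq_iff)
qed

text \<open>By symmetry of the Hessian the mixed blocks cancel. What remains is the quadratic form
  of the y-block minus that of the x-block, both with known sign.\<close>

lemma H_mat_dissipative:
  assumes C2: "C2_fun f" and saddle: "saddle_point f z"
  shows "inner u (H_mat f z *v u) \<le> 0"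
proof -
  \<comment> \<open>\<open>X\<close> and \<open>Y\<close> are the x-part and the y-part of
    \<open>u\<close>.\<close>
  define X where "X = (1 / 2) *\<^sub>R (u + flip_y u)"
  define Y where "Y = (1 / 2) *\<^sub>R (u - flip_y u)"
  let ?D = "(*v) (hessian f z)"
  have u: "u = X + Y" by (simp add: X_def Y_def flip: scaleR_add_right)
  have flip: "flip_y u = X - Y" by (simp add: X_def Y_def flip: scaleR_diff_right)
  have "X $ Inr j = 0" "Y $ Inl i = 0" for i j
    by (simp_all add: X_def Y_def flip_y_def)
  then have XY: "0 \<le> inner (?D X) X" "inner (?D Y) Y \<le> 0"
    using saddle_point_conditions[OF C2 saddle] by blast+
  have "inner u (H_mat f z *v u) = - inner (flip_y u) (?D u)"
    using C2 by (simp add: H_mat_mult C2_fun_def inner_flip_y_left)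
  also have "\<dots> = - inner (X - Y) (?D (X + Y))"
    unfolding flip by (simp flip: u)
  also have "\<dots> = inner (?D Y) Y - inner (?D X) X"
    using hessian_symmetric[OF C2, of z X Y]
    by (simp add: matrix_vector_right_distrib inner_simps inner_commute)
  finally show ?thesis using XY by linarith
qed

section \<open>The scaling matrix and the sign of the spectrum\<close>

definition Lambda_weight :: "real \<Rightarrow> 'n + 'm \<Rightarrow> real" where
  "Lambda_weight \<tau> k = (case k of Inl i \<Rightarrow> 1 / \<tau> | Inr j \<Rightarrow> 1)"

lemma Lambda_mult: "(Lambda_mat \<tau> *v v) $ k = Lambda_weight \<tau> k * v $ k"
  by (simp add: Lambda_mat_def Lambda_weight_def matrix_vector_mult_def if_distrib[of "\<lambda>x. x * _"] cong: if_cong)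

lemma Lambda_weight_pos: "\<tau> > 0 \<Longrightarrow> Lambda_weight \<tau> k > 0"
  by (simp add: Lambda_weight_def split: sum.split)

lemma norm_Lambda_mult_le:
  fixes v :: "real ^ ('n::finite + 'm::finite)"
  assumes "\<tau> > 0"
  shows "norm (Lambda_mat \<tau> *v v) \<le> max 1 (1 / \<tau>) * norm v"
proof -
  have "norm (Lambda_mat \<tau> *v v) \<le> norm (max 1 (1 / \<tau>) *\<^sub>R v)"
  proof (rule norm_le_componentwise_cart)
    fix k :: "'n + 'm"
    have "Lambda_weight \<tau> k \<le> max 1 (1 / \<tau>)" by (simp add: Lambda_weight_def split: sum.split)
    then show "norm ((Lambda_mat \<tau> *v v) $ k) \<le> norm ((max 1 (1 / \<tau>) *\<^sub>R v) $ k)"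
      using Lambda_weight_pos[OF assms, of k] by (simp add: Lambda_mult abs_mult mult_right_mono)
  qed
  then show ?thesis by simp
qed

text \<open>Dividing the eigenvalue equations by the weights isolates \<open>H\<close>. Testing them
  with \<open>p\<close> and \<open>q\<close> and adding removes the imaginary part, which leaves
  \<open>Re \<mu>\<close> times a squared norm of the eigenvector, weighted by the inverse of the
  scaling.\<close>

lemma cspectrum_Lambda_Re_nonpos:
  assumes "\<tau> > 0" and dissipative: "\<And>u. inner u (H *v u) \<le> 0"
    and "\<mu> \<in> cspectrum (Lambda_mat \<tau> ** H)"
  shows "Re \<mu> \<le> 0"
proof -
  obtain p q where pq: "p \<noteq> 0 \<or> q \<noteq> 0"
    "Lambda_mat \<tau> *v (H *v p) = Re \<mu> *\<^sub>R p - Im \<mu> *\<^sub>R q"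
    "Lambda_mat \<tau> *v (H *v q) = Re \<mu> *\<^sub>R q + Im \<mu> *\<^sub>R p"
    using cspectrum_real_imag[OF assms(3)] by (auto simp: matrix_vector_mul_assoc)
  let ?l = "Lambda_weight \<tau>"
  define S where "S = (\<Sum>k\<in>UNIV. ((p $ k)\<^sup>2 + (q $ k)\<^sup>2) / ?l k)"
  have l: "?l k > 0" for k by (rule Lambda_weight_pos[OF \<open>\<tau> > 0\<close>])
  have Hp: "(H *v p) $ k = (Re \<mu> * p $ k - Im \<mu> * q $ k) / ?l k" for k
    using arg_cong[OF pq(2), of "\<lambda>v. v $ k"] l[of k] by (simp add: Lambda_mult field_simps)
  have Hq: "(H *v q) $ k = (Re \<mu> * q $ k + Im \<mu> * p $ k) / ?l k" for k
    using arg_cong[OF pq(3), of "\<lambda>v. v $ k"] l[of k] by (simp add: Lambda_mult field_simps)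
  have "inner p (H *v p) + inner q (H *v q) = Re \<mu> * S"
    unfolding inner_vec_def S_def sum_distrib_left Hp Hq sum.distrib[symmetric]
    by (rule sum.cong) (simp_all add: power2_eq_square algebra_simps add_divide_distrib diff_divide_distrib)
  then have "Re \<mu> * S \<le> 0" using dissipative[of p] dissipative[of q] by simp
  moreover obtain k where k: "p $ k \<noteq> 0 \<or> q $ k \<noteq> 0" using pq(1) by (auto simp: vec_eq_iff)
  have "((p $ k)\<^sup>2 + (q $ k)\<^sup>2) / ?l k > 0"
    using k l[of k] by (auto simp: add_pos_nonneg add_nonneg_pos)
  then have "S > 0"
    unfolding S_def using l by (intro sum_pos2[where i = k]) (auto intro!: divide_nonneg_pos)
  ultimately show ?thesis by (simp add: mult_le_0_iff)
qed

section \<open>Stability for the two fields\<close>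

lemma bounded_bilinear_matrix_vector_mult:
  "bounded_bilinear ((*v) :: real ^ 'n ^ 'm \<Rightarrow> real ^ 'n \<Rightarrow> real ^ 'm)"
  unfolding bilinear_conv_bounded_bilinear[symmetric] bilinear_def
  by (auto intro!: linearI simp: matrix_vector_mult_add_rdistrib matrix_vector_right_distrib
      scaleR_matrix_vector_assoc matrix_vector_mult_scaleR)

interpretation matrix_vector_mult:
  bounded_bilinear "(*v) :: real ^ 'n ^ 'm \<Rightarrow> real ^ 'n \<Rightarrow> real ^ 'm"
  by (rule bounded_bilinear_matrix_vector_mult)

lemma exp_stable_first_order:
  assumes C2: "C2_fun f" and saddle: "saddle_point f z" and "\<tau> > 0" "\<gamma> > 0"
    and hyp: "\<forall>\<mu>\<in>cspectrum (Lambda_mat \<tau> ** H_mat f z). Re \<mu> \<noteq> 0"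
  shows "exp_stable_equilibrium (\<lambda>z. - \<gamma> *\<^sub>R (Lambda_mat \<tau> *v saddle_field f z)) z"
proof (rule hurwitz_exp_stable)
  show "- \<gamma> *\<^sub>R (Lambda_mat \<tau> *v saddle_field f z) = 0"
    by (simp add: saddle_field_flip saddle_point_grad[OF C2 saddle] linear_0[OF linear_flip_y])
  have "((\<lambda>z. - \<gamma> *\<^sub>R (Lambda_mat \<tau> *v saddle_field f z)) has_derivative
      (\<lambda>h. - \<gamma> *\<^sub>R (Lambda_mat \<tau> *v - (H_mat f z *v h)))) (at z)"
    using C2 by (intro has_derivative_scaleR_right has_derivative_saddle_field
        bounded_linear.has_derivative[OF matrix_vector_mul_bounded_linear]) (simp add: C2_fun_def)
  moreover have "- \<gamma> *\<^sub>R (Lambda_mat \<tau> *v - (H_mat f z *v h)) = (\<gamma> *\<^sub>R (Lambda_mat \<tau> ** H_mat f z)) *v h" for h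
    by (simp add: matrix_vector_mult.minus_left matrix_vector_mult.minus_right
        matrix_vector_mult.scaleR_left flip: matrix_vector_mul_assoc)
  ultimately show "((\<lambda>z. - \<gamma> *\<^sub>R (Lambda_mat \<tau> *v saddle_field f z)) has_derivative
      (*v) (\<gamma> *\<^sub>R (Lambda_mat \<tau> ** H_mat f z))) (at z)"
    by (simp only:)
  show "\<forall>\<mu>\<in>cspectrum (\<gamma> *\<^sub>R (Lambda_mat \<tau> ** H_mat f z)). Re \<mu> < 0"
  proof
    fix \<mu> assume "\<mu> \<in> cspectrum (\<gamma> *\<^sub>R (Lambda_mat \<tau> ** H_mat f z))"
    with \<open>\<gamma> > 0\<close> obtain \<nu> where \<nu>: "\<nu> \<in> cspectrum (Lambda_mat \<tau> ** H_mat f z)" "\<mu> = of_real \<gamma> * \<nu>"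
      using cspectrum_scaleR by (metis less_irrefl)
    have "Re \<nu> < 0"
      using cspectrum_Lambda_Re_nonpos[OF \<open>\<tau> > 0\<close> H_mat_dissipative[OF C2 saddle] \<nu>(1)] hyp \<nu>(1)
      by fastforce
    then show "Re \<mu> < 0" using \<open>\<gamma> > 0\<close> by (simp add: \<nu>(2) mult_pos_neg)
  qed
qed

text \<open>In terms of \<open>?w\<close>, which vanishes at the saddle point and has derivative
  \<open>- A\<close> there, the field is a multiple of \<open>?w\<close> plus a product of
  \<open>H_mat\<close> with \<open>?w\<close>. The product rule with a continuous factor handles the
  latter.\<close>

lemma has_derivative_second_order_field:
  fixes \<tau> :: real
  assumes C2: "C2_fun f" and saddle: "saddle_point f z"
  defines "A \<equiv> Lambda_mat \<tau> ** H_mat f z"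
  shows "((\<lambda>z. (- mat 1 + c *\<^sub>R (Lambda_mat \<tau> ** jacobian (saddle_field f) (at z)))
            *v (\<gamma> *\<^sub>R (Lambda_mat \<tau> *v saddle_field f z))) has_derivative
          (*v) (\<gamma> *\<^sub>R (A + c *\<^sub>R (A ** A)))) (at z)"
proof -
  let ?w = "\<lambda>x. Lambda_mat \<tau> *v saddle_field f x"
  have w: "(?w has_derivative (\<lambda>h. Lambda_mat \<tau> *v - (H_mat f z *v h))) (at z)"
    using C2 by (intro has_derivative_saddle_field
        bounded_linear.has_derivative[OF matrix_vector_mul_bounded_linear]) (simp add: C2_fun_def)
  have w0: "?w z = 0"
    by (simp add: saddle_field_flip saddle_point_grad[OF C2 saddle] linear_0[OF linear_flip_y])
  have "((\<lambda>x. (- \<gamma>) *\<^sub>R ?w x - (\<gamma> * c) *\<^sub>R (Lambda_mat \<tau> *v (H_mat f x *v ?w x))) has_derivative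
      (\<lambda>h. (- \<gamma>) *\<^sub>R (Lambda_mat \<tau> *v - (H_mat f z *v h)) -
        (\<gamma> * c) *\<^sub>R (Lambda_mat \<tau> *v (H_mat f z *v (Lambda_mat \<tau> *v - (H_mat f z *v h)))))) (at z)"
    by (intro has_derivative_diff has_derivative_scaleR_right w
        bounded_linear.has_derivative[OF matrix_vector_mul_bounded_linear]
        has_derivative_bilinear_at_zero[OF bounded_bilinear_matrix_vector_mult w w0 isCont_H_mat[OF C2]])
  moreover have "(- \<gamma>) *\<^sub>R (Lambda_mat \<tau> *v - (H_mat f z *v h)) -
        (\<gamma> * c) *\<^sub>R (Lambda_mat \<tau> *v (H_mat f z *v (Lambda_mat \<tau> *v - (H_mat f z *v h)))) =
      (\<gamma> *\<^sub>R (A + c *\<^sub>R (A ** A))) *v h" for h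
    by (simp add: A_def vec.neg matrix_vector_mult_add_rdistrib scaleR_add_right
        flip: scaleR_matrix_vector_assoc matrix_vector_mul_assoc)
  moreover have "(- \<gamma>) *\<^sub>R ?w x - (\<gamma> * c) *\<^sub>R (Lambda_mat \<tau> *v (H_mat f x *v ?w x)) =
      (- mat 1 + c *\<^sub>R (Lambda_mat \<tau> ** jacobian (saddle_field f) (at x))) *v (\<gamma> *\<^sub>R ?w x)" for x
    by (simp add: jacobian_saddle_field matrix_vector_mult.diff_left matrix_vector_mult.scaleR_left
        matrix_vector_mult.scaleR_right matrix_vector_mult.minus_left matrix_vector_mult.minus_right
        scaleR_diff_right flip: matrix_vector_mul_assoc)
  ultimately show ?thesis by simp
qed

text \<open>The Lipschitz constant bounds the Hessian, hence \<open>max 1 (1 / \<tau>) * L\<close>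
  bounds all eigenvalues of the scaled matrix. The hypothesis \<open>small\<close> thus keeps
  \<open>1 + c * Re \<nu>\<close> positive.\<close>

lemma exp_stable_second_order:
  assumes C2: "C2_fun f" and saddle: "saddle_point f z" and "\<tau> > 0" "\<gamma> > 0" "c > 0"
    and lip: "L-lipschitz_on UNIV (grad f)" and inv: "invertible (hessian f z)"
    and small: "c * (max 1 (1 / \<tau>) * L) < 1"
  shows "exp_stable_equilibrium
    (\<lambda>z. (- mat 1 + c *\<^sub>R (Lambda_mat \<tau> ** jacobian (saddle_field f) (at z)))
      *v (\<gamma> *\<^sub>R (Lambda_mat \<tau> *v saddle_field f z))) z"
proof (rule hurwitz_exp_stable[OF _ has_derivative_second_order_field[OF C2 saddle]])
  show "(- mat 1 + c *\<^sub>R (Lambda_mat \<tau> ** jacobian (saddle_field f) (at z)))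
      *v (\<gamma> *\<^sub>R (Lambda_mat \<tau> *v saddle_field f z)) = 0"
    by (simp add: saddle_field_flip saddle_point_grad[OF C2 saddle] linear_0[OF linear_flip_y])
  let ?A = "Lambda_mat \<tau> ** H_mat f z"
  have diff: "grad f differentiable (at z)" using C2 by (simp add: C2_fun_def)
  have "norm (?A *v u) \<le> max 1 (1 / \<tau>) * L * norm u" for u
  proof -
    have "norm (?A *v u) \<le> max 1 (1 / \<tau>) * norm (H_mat f z *v u)"
      using norm_Lambda_mult_le[OF \<open>\<tau> > 0\<close>] by (simp flip: matrix_vector_mul_assoc)
    also have "norm (H_mat f z *v u) \<le> L * norm u"
      using lipschitz_derivative_norm_le[OF lip has_derivative_hessian[OF diff]]
      by (simp add: H_mat_mult[OF diff])
    finally show ?thesis by (simp add: mult.assoc mult_left_mono)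
  qed
  then have bound: "cmod \<nu> \<le> max 1 (1 / \<tau>) * L" if "\<nu> \<in> cspectrum ?A" for \<nu>
    using that by (rule cspectrum_norm_le)
  have nonzero: "\<nu> \<noteq> 0" if \<nu>: "\<nu> \<in> cspectrum ?A" for \<nu>
  proof
    assume "\<nu> = 0"
    obtain p q where "p \<noteq> 0 \<or> q \<noteq> 0" "?A *v p = Re \<nu> *\<^sub>R p - Im \<nu> *\<^sub>R q" "?A *v q = Re \<nu> *\<^sub>R q + Im \<nu> *\<^sub>R p"
      using cspectrum_real_imag[OF \<nu>] by blast
    \<comment> \<open>For the eigenvalue 0 the real or the imaginary part of the eigenvector is a
      nonzero real null vector. It is also a null vector of the Hessian, against
      invertibility.\<close>
    with \<open>\<nu> = 0\<close> obtain u where u: "u \<noteq> 0" "?A *v u = 0" by auto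
    have "(H_mat f z *v u) $ k = 0" for k
      using arg_cong[OF u(2), of "\<lambda>v. v $ k"] Lambda_weight_pos[OF \<open>\<tau> > 0\<close>, of k]
      by (simp add: Lambda_mult flip: matrix_vector_mul_assoc)
    then have "H_mat f z *v u = 0" by (simp add: vec_eq_iff)
    then have "hessian f z *v u = 0"
      using norm_flip_y[of "hessian f z *v u"] by (simp add: H_mat_mult[OF diff])
    with inj_matrix_vector_mult[OF inv] u(1) show False
      by (metis injD matrix_vector_mult_0_right)
  qed
  show "\<forall>\<mu>\<in>cspectrum (\<gamma> *\<^sub>R (?A + c *\<^sub>R (?A ** ?A))). Re \<mu> < 0"
  proof
    fix \<mu> assume "\<mu> \<in> cspectrum (\<gamma> *\<^sub>R (?A + c *\<^sub>R (?A ** ?A)))"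
    then obtain \<mu>' where \<mu>': "\<mu>' \<in> cspectrum (?A + c *\<^sub>R (?A ** ?A))" "\<mu> = of_real \<gamma> * \<mu>'"
      using cspectrum_scaleR \<open>\<gamma> > 0\<close> by (metis less_irrefl)
    then obtain \<nu> where \<nu>: "\<nu> \<in> cspectrum ?A" "\<mu>' = \<nu> + of_real c * \<nu>\<^sup>2"
      using cspectrum_quadratic \<open>c > 0\<close> by (metis less_irrefl)
    have "Re \<nu> \<le> 0"
      by (rule cspectrum_Lambda_Re_nonpos[OF \<open>\<tau> > 0\<close> H_mat_dissipative[OF C2 saddle] \<nu>(1)])
    have "c * \<bar>Re \<nu>\<bar> \<le> c * (max 1 (1 / \<tau>) * L)"
      using \<open>c > 0\<close> bound[OF \<nu>(1)] abs_Re_le_cmod[of \<nu>] by (intro mult_left_mono) auto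
    with small \<open>Re \<nu> \<le> 0\<close> have "1 + c * Re \<nu> > 0" by simp
    have "Re \<mu>' = Re \<nu> * (1 + c * Re \<nu>) - c * (Im \<nu>)\<^sup>2"
      by (simp add: \<nu>(2) power2_eq_square algebra_simps)
    also have "\<dots> < 0"
    proof (cases "Re \<nu> = 0")
      \<comment> \<open>On the imaginary axis the decay comes from the quadratic term alone.\<close>
      case True
      with nonzero[OF \<nu>(1)] have "Im \<nu> \<noteq> 0" by (simp add: complex_eq_iff)
      with True \<open>c > 0\<close> show ?thesis by simp
    next
      case False
      with \<open>Re \<nu> \<le> 0\<close> \<open>1 + c * Re \<nu> > 0\<close> have "Re \<nu> * (1 + c * Re \<nu>) < 0"
        by (simp add: mult_neg_pos)
      moreover have "c * (Im \<nu>)\<^sup>2 \<ge> 0" using \<open>c > 0\<close> by simp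
      ultimately show ?thesis by linarith
    qed
    finally show "Re \<mu> < 0" using \<open>\<gamma> > 0\<close> by (simp add: \<mu>'(2) mult_pos_neg)
  qed
qed

theorem theorem4p6:
  fixes f :: "real ^ ('n::finite + 'm::finite) \<Rightarrow> real"
    and L \<tau> :: real
  assumes "C2_fun f"
    and "L > 0"
    and "L-lipschitz_on UNIV (grad f)"
    and "\<forall>z. saddle_point f z \<longrightarrow> invertible (hessian f z)"
    and "\<tau> > 0"
  shows "(\<forall>\<gamma>::real. \<gamma> > 0 \<and>
            (\<forall>z. saddle_point f z \<longrightarrow> (\<forall>\<mu>\<in>cspectrum (Lambda_mat \<tau> ** H_mat f z). Re \<mu> \<noteq> 0)) \<longrightarrow>
            {z. saddle_point f z} \<subseteq>
            {z. exp_stable_equilibrium (\<lambda>z. - \<gamma> *\<^sub>R (Lambda_mat \<tau> *v saddle_field f z)) z})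
    \<and> (\<forall>\<gamma> s :: real. 0 < \<gamma> \<and> \<gamma> < 2 \<and>
            (\<forall>z. saddle_point f z \<longrightarrow>
               0 < s \<and> ereal s < min (M_bound f L \<tau> z) (ereal (min (1 / L) (\<tau> / L)))) \<longrightarrow>
            {z. saddle_point f z} \<subseteq>
            {z. exp_stable_equilibrium
                  (\<lambda>z. (- mat 1 + ((1 - \<gamma> / 2) * s) *\<^sub>R
                           (Lambda_mat \<tau> ** jacobian (saddle_field f) (at z)))
                         *v (\<gamma> *\<^sub>R (Lambda_mat \<tau> *v saddle_field f z))) z})"
proof (rule conjI; intro allI impI subsetI; elim conjE; unfold mem_Collect_eq)
  fix \<gamma> :: real and z
  assume "\<gamma> > 0" "saddle_point f z"
    and "\<forall>z. saddle_point f z \<longrightarrow> (\<forall>\<mu>\<in>cspectrum (Lambda_mat \<tau> ** H_mat f z). Re \<mu> \<noteq> 0)"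
  then show "exp_stable_equilibrium (\<lambda>z. - \<gamma> *\<^sub>R (Lambda_mat \<tau> *v saddle_field f z)) z"
    using exp_stable_first_order[OF assms(1) _ assms(5)] by blast
next
  fix \<gamma> s :: real and z
  assume \<gamma>: "0 < \<gamma>" "\<gamma> < 2" and z: "saddle_point f z"
    and "\<forall>z. saddle_point f z \<longrightarrow>
      0 < s \<and> ereal s < min (M_bound f L \<tau> z) (ereal (min (1 / L) (\<tau> / L)))"
  then have s: "0 < s" "s < 1 / L" "s < \<tau> / L" by auto
  \<comment> \<open>For \<open>\<gamma>\<close> between 0 and 2 the factor of \<open>s\<close> lies
    strictly between 0 and 1, so the upper bounds on \<open>s\<close> pass to
    \<open>c\<close>.\<close>
  define c where "c = (1 - \<gamma> / 2) * s"
  have c: "0 < c" "c < s" using \<gamma> s by (simp_all add: c_def)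
  \<comment> \<open>The bounds \<open>1 / L\<close> and \<open>\<tau> / L\<close> are the two cases
    of the maximum of 1 and \<open>1 / \<tau>\<close>.\<close>
  have "s * L < 1" "s * (1 / \<tau>) * L < 1"
    using s \<open>L > 0\<close> \<open>\<tau> > 0\<close> by (simp_all add: field_simps)
  then have "s * (max 1 (1 / \<tau>) * L) < 1"
    by (simp add: max_def)
  moreover have "c * (max 1 (1 / \<tau>) * L) \<le> s * (max 1 (1 / \<tau>) * L)"
    using c \<open>L > 0\<close> by (intro mult_right_mono) (auto simp: less_max_iff_disj less_imp_le)
  ultimately have "c * (max 1 (1 / \<tau>) * L) < 1" by linarith
  with assms z \<gamma> c show "exp_stable_equilibrium
      (\<lambda>z. (- mat 1 + ((1 - \<gamma> / 2) * s) *\<^sub>R (Lambda_mat \<tau> ** jacobian (saddle_field f) (at z)))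
        *v (\<gamma> *\<^sub>R (Lambda_mat \<tau> *v saddle_field f z))) z"
    unfolding c_def[symmetric] by (intro exp_stable_second_order) auto
qed

end
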